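(* Let $G$ be any finite simple graph. Then \[ \left|I(G;-1)\right| \le \min_{D\in \Phi_3(G)} \left|\mathrm{Ind}(G[D])\right| \le 2^{\phi_3(G)}. \]
   Context: For a finite simple graph $G$, the independence polynomial is $I(G;x)=\sum_{k\ge 0} i_k(G)x^k$, where $i_k(G)$ is the number of independent sets of $G$ of size $k$ (with $i_0(G)=1$, counting the empty set). A $\tilde{3}$-cycle is a cycle whose length is divisible by $3$. A graph is called ternary if it contains no induced $\tilde{3}$-cycle. A set $D\subseteq V(G)$ is a $\tilde{3}$-decycling set of $G$ if $G-D$ is ternary; $\Phi_3(G)$ denotes the set of all $\tilde{3}$-decycling sets of $G$, and $\phi_3(G)$ is the minimum size of a $\tilde{3}$-decycling set of $G$. For $D\subseteq V(G)$, $G[D]$ is the subgraph of $G$ induced by $D$. For a graph $H$, $\mathrm{Ind}(H)$ is the independence complex of $H$, i.e., the family of all independent sets of $H$ (including the empty set), so $\left|\mathrm{Ind}(H)\right|$ is the total number of independent sets of $H$. *)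

theory Defs
  imports Main
begin

text \<open>A finite simple graph is given by a finite vertex set V and a symmetric,
irreflexive adjacency relation E. The induced subgraph G[D] is (D, E) for D a subset of V.\<close>

definition simple_graph :: "'a set \<Rightarrow> ('a \<Rightarrow> 'a \<Rightarrow> bool) \<Rightarrow> bool" where
  "simple_graph V E \<longleftrightarrow> finite V \<and> (\<forall>u v. E u v \<longrightarrow> E v u) \<and> (\<forall>v. \<not> E v v)"

definition indep_set :: "'a set \<Rightarrow> ('a \<Rightarrow> 'a \<Rightarrow> bool) \<Rightarrow> 'a set \<Rightarrow> bool" where
  "indep_set V E S \<longleftrightarrow> S \<subseteq> V \<and> (\<forall>u\<in>S. \<forall>v\<in>S. \<not> E u v)"

definition Ind :: "'a set \<Rightarrow> ('a \<Rightarrow> 'a \<Rightarrow> bool) \<Rightarrow> 'a set set" where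
  "Ind V E = {S. indep_set V E S}"

definition indep_count :: "'a set \<Rightarrow> ('a \<Rightarrow> 'a \<Rightarrow> bool) \<Rightarrow> nat \<Rightarrow> nat" where
  "indep_count V E k = card {S. indep_set V E S \<and> card S = k}"

definition indep_poly :: "'a set \<Rightarrow> ('a \<Rightarrow> 'a \<Rightarrow> bool) \<Rightarrow> 'b::comm_ring_1 \<Rightarrow> 'b" where
  "indep_poly V E x = (\<Sum>k\<le>card V. of_nat (indep_count V E k) * x ^ k)"

definition induced_cycle :: "'a set \<Rightarrow> ('a \<Rightarrow> 'a \<Rightarrow> bool) \<Rightarrow> 'a list \<Rightarrow> bool" where
  "induced_cycle V E cs \<longleftrightarrow> distinct cs \<and> length cs \<ge> 3 \<and> set cs \<subseteq> V \<and>
     (\<forall>i<length cs. \<forall>j<length cs.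
        E (cs ! i) (cs ! j) \<longleftrightarrow> (j = Suc i mod length cs \<or> i = Suc j mod length cs))"

definition ternary :: "'a set \<Rightarrow> ('a \<Rightarrow> 'a \<Rightarrow> bool) \<Rightarrow> bool" where
  "ternary V E \<longleftrightarrow> \<not> (\<exists>cs. induced_cycle V E cs \<and> 3 dvd length cs)"

definition decycling3 :: "'a set \<Rightarrow> ('a \<Rightarrow> 'a \<Rightarrow> bool) \<Rightarrow> 'a set set" where
  "decycling3 V E = {D. D \<subseteq> V \<and> ternary (V - D) E}"

definition phi3 :: "'a set \<Rightarrow> ('a \<Rightarrow> 'a \<Rightarrow> bool) \<Rightarrow> nat" where
  "phi3 V E = Min (card ` decycling3 V E)"

end

theory Submission
  imports Defs
begin

text \<open>Let \<open>F X Y\<close> be the alternating count of the independent subsets of \<open>W\<close> that contain \<open>X\<close>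
and avoid \<open>Y\<close>. Fixing the trace of an independent set on a decycling set leaves one alternating
count on a ternary graph for each independent subset of the decycling set, so it suffices that
these counts are at most 1 in absolute value on ternary graphs.

That bound is proved by induction on \<open>W\<close> together with the turning inequality
\<open>F {} {} * F {} {a, b} \<le> F {} {a} * F {} {b}\<close>. Assuming both for proper subsets, suppose one of them
fails on \<open>W\<close>. Around a vertex, take a minimal nonempty set of neighbours whose deletion together
with the vertex leaves a nonzero count (a circuit). A circuit around \<open>s\<close> through \<open>x\<close> and a circuit
around \<open>x\<close> through \<open>s\<close> exclude each other, because together they force a count of modulus 2.
If the turning inequality fails at a nonadjacent pair, two such circuits exist; for an adjacent
pair it then follows because there are no triangles. If the bound fails, then \<open>F {} {} = 2\<close> up to
sign, the relation \<open>F {a, b} {} = 1\<close> is an equivalence, and a walk that never returns to the class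
it left two steps earlier runs periodically through three classes; a shortest directed cycle
between them is induced and has length divisible by 3.\<close>

section \<open>Sieves and circuits\<close>

definition nbhd :: "('a \<Rightarrow> 'a \<Rightarrow> bool) \<Rightarrow> 'a set \<Rightarrow> 'a \<Rightarrow> 'a set" where
  "nbhd E W v = {w \<in> W. E v w}"

text \<open>Abstracts the alternating counts, with the induction hypothesis as \<open>bound\<close> and \<open>turn\<close>:
  fixing any vertex of \<open>W\<close> reduces the count to a proper subset of \<open>W\<close>.\<close>
locale sieve =
  fixes E :: "'a \<Rightarrow> 'a \<Rightarrow> bool" and W :: "'a set" and F :: "'a set \<Rightarrow> 'a set \<Rightarrow> int"
  assumes fin: "finite W"
    and sym: "E a b \<Longrightarrow> E b a"
    and irr: "\<not> E a a"
    and split: "F X Y = F (insert u X) Y + F X (insert u Y)"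
    and edge: "a \<in> X \<Longrightarrow> b \<in> X \<Longrightarrow> E a b \<Longrightarrow> F X Y = 0"
    and bound: "(X \<union> Y) \<inter> W \<noteq> {} \<Longrightarrow> \<bar>F X Y\<bar> \<le> 1"
    and turn: "(X \<union> Y) \<inter> W \<noteq> {} \<Longrightarrow> a \<noteq> b \<Longrightarrow>
      F X Y * F X (insert a (insert b Y)) \<le> F X (insert a Y) * F X (insert b Y)"
begin

section \<open>Absorption and the counts at a circuit\<close>

lemma absorb: "a \<in> X \<Longrightarrow> E a b \<Longrightarrow> F X (insert b Y) = F X Y"
  using split[of X Y b] edge[of a "insert b X" b Y] by simp

lemma absorb_set:
  assumes "finite B" "\<And>b. b \<in> B \<Longrightarrow> \<exists>a\<in>X. E a b"
  shows "F X (B \<union> Y) = F X Y"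
  using assms
proof (induction B)
  case (insert b B)
  obtain a where "a \<in> X" "E a b" using insert.prems[of b] by blast
  then have "F X (insert b (B \<union> Y)) = F X (B \<union> Y)" by (rule absorb)
  moreover have "F X (B \<union> Y) = F X Y" using insert.IH insert.prems by blast
  ultimately show ?case by simp
qed simp

text \<open>If moreover \<open>F {} (Z \<union> Q) \<noteq> 0\<close>, then \<open>Z\<close> is a circuit relative to \<open>Q\<close>.\<close>
definition null_below :: "'a set \<Rightarrow> 'a set \<Rightarrow> bool" where
  "null_below Z Q \<longleftrightarrow> finite Z \<and> (\<forall>Y. Y \<noteq> {} \<longrightarrow> Y \<subset> Z \<longrightarrow> F {} (Y \<union> Q) = 0)"

text \<open>By inclusion-exclusion, selecting \<open>X\<close> is the signed sum over the subsets
  \<open>T\<close> of \<open>X\<close> of the counts with \<open>T\<close> deleted instead. Each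
  \<open>T \<union> Y\<close> is a nonempty subset of \<open>Z\<close>, so only
  \<open>T \<union> Y = Z\<close> can contribute.\<close>

lemma null_below_out:
  assumes Z: "null_below Z Q" and "finite X"
  shows "Y \<noteq> {} \<Longrightarrow> X \<inter> Y = {} \<Longrightarrow>
    (X \<union> Y \<subset> Z \<longrightarrow> F X (Y \<union> Q) = 0) \<and>
    (X \<union> Y = Z \<longrightarrow> F X (Y \<union> Q) = (- 1) ^ card X * F {} (Z \<union> Q))"
  using \<open>finite X\<close>
proof (induction X arbitrary: Y)
  case empty
  then show ?case using Z unfolding null_below_def by simp
next
  case (insert a X)
  have sp: "F (insert a X) (Y \<union> Q) = F X (Y \<union> Q) - F X (insert a Y \<union> Q)"
    using split[of X "Y \<union> Q" a] by simp
  have eq: "insert a X \<union> Y = X \<union> insert a Y" by simp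
  have dj: "X \<inter> Y = {}" "X \<inter> insert a Y = {}" "insert a Y \<noteq> {}" and "a \<notin> X \<union> Y"
    using insert.hyps insert.prems by auto
  have zero: "F X (Y \<union> Q) = 0" if "X \<union> insert a Y \<subseteq> Z"
  proof -
    have "X \<union> Y \<subset> Z" using that \<open>a \<notin> X \<union> Y\<close> by blast
    then show ?thesis using insert.IH[OF insert.prems(1) dj(1)] by blast
  qed
  have IH: "X \<union> insert a Y \<subset> Z \<Longrightarrow> F X (insert a Y \<union> Q) = 0"
    "X \<union> insert a Y = Z \<Longrightarrow> F X (insert a Y \<union> Q) = (- 1) ^ card X * F {} (Z \<union> Q)"
    using insert.IH[OF dj(3,2)] by blast+
  show ?case unfolding eq sp
  proof (intro conjI impI)
    assume *: "X \<union> insert a Y \<subset> Z"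
    show "F X (Y \<union> Q) - F X (insert a Y \<union> Q) = 0"
      using zero[OF psubset_imp_subset[OF *]] IH(1)[OF *] by linarith
  next
    assume *: "X \<union> insert a Y = Z"
    show "F X (Y \<union> Q) - F X (insert a Y \<union> Q) = (- 1) ^ card (insert a X) * F {} (Z \<union> Q)"
      using zero[OF equalityD1[OF *]] IH(2)[OF *] insert.hyps by simp
  qed
qed

lemma null_below_part:
  assumes "null_below Z Q" "Y \<noteq> {}" "X \<inter> Y = {}" "X \<union> Y \<subset> Z"
  shows "F X (Y \<union> Q) = 0"
proof -
  have "finite Z" using assms(1) unfolding null_below_def by (rule conjunct1)
  then have "finite X" by (rule rev_finite_subset) (use assms(4) in blast)
  from null_below_out[OF assms(1) this assms(2,3)] assms(4) show ?thesis by (rule mp[OF conjunct1])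
qed

lemma null_below_compl:
  assumes "null_below Z Q" "X \<subset> Z"
  shows "F X ((Z - X) \<union> Q) = (- 1) ^ card X * F {} (Z \<union> Q)"
proof -
  have "finite Z" using assms(1) unfolding null_below_def by (rule conjunct1)
  then have "finite X" by (rule rev_finite_subset) (use assms(2) in blast)
  moreover have "Z - X \<noteq> {}" "X \<inter> (Z - X) = {}" "X \<union> (Z - X) = Z" using assms(2) by blast+
  ultimately show ?thesis
    using conjunct2[OF null_below_out[OF assms(1), of X "Z - X"]] by (metis (no_types))
qed

text \<open>Without \<open>Y\<close> the inclusion-exclusion sum also contains the empty deletion,
  which for a proper subset of \<open>Z\<close> is the only surviving term.\<close>

lemma null_below_in:
  assumes Z: "null_below Z Q" and "X \<subset> Z"
  shows "F X Q = F {} Q"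
proof -
  have "finite X" using assms finite_subset unfolding null_below_def by blast
  then show ?thesis using \<open>X \<subset> Z\<close>
  proof (induction X)
    case (insert a X)
    then have "X \<inter> {a} = {}" "X \<union> {a} \<subset> Z" "X \<subset> Z" by auto
    then have "F X ({a} \<union> Q) = 0" "F X Q = F {} Q"
      using null_below_part[OF Z, of "{a}" X] insert.IH by simp_all
    then show ?case using split[of X Q a] by simp
  qed simp
qed

text \<open>For \<open>X = Z\<close> two terms survive: deleting nothing and deleting all of
  \<open>Z\<close>. Together with the bound this ties the parity of \<open>card Z\<close> to the
  sign of the value at the circuit.\<close>

lemma null_below_full:
  assumes Z: "null_below Z Q" and "Z \<noteq> {}"
  shows "F Z Q = F {} Q + (- 1) ^ card Z * F {} (Z \<union> Q)"
proof -
  obtain a where a: "a \<in> Z" using assms by blast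
  have fin: "finite Z" using Z unfolding null_below_def by blast
  let ?X = "Z - {a}"
  have X: "?X \<subset> Z" "Z - ?X = {a}" "insert a ?X = Z" using a by blast+
  then have "F ?X Q = F {} Q" "F ?X ({a} \<union> Q) = (- 1) ^ card ?X * F {} (Z \<union> Q)"
    using null_below_in[OF Z X(1)] null_below_compl[OF Z X(1)] by simp_all
  moreover have "card Z = Suc (card ?X)" using a fin by (metis card.remove)
  ultimately show ?thesis using split[of ?X Q a] X(3) by simp
qed

text \<open>Deleting further neighbours of a member of the circuit is invisible:
  the bound and the turning inequality leave no room for a change.\<close>
lemma shield:
  assumes Z: "null_below Z Q" and c: "F {} (Z \<union> Q) \<noteq> 0" and Q: "Q \<inter> W \<noteq> {}"
    and x: "x \<in> Z" and X: "X \<subseteq> Z" "x \<notin> X" "insert x X \<noteq> Z"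
    and S: "finite S" "\<And>u. u \<in> S \<Longrightarrow> E x u"
  shows "F X (S \<union> ((Z - X) \<union> Q)) = F X ((Z - X) \<union> Q)"
  using S
proof (induction S)
  case (insert u S)
  define \<tau> where "\<tau> = (- 1) ^ card X * F {} (Z \<union> Q)"
  define R where "R = S \<union> ((Z - insert x X) \<union> Q)"
  have finX: "finite X" using Z X finite_subset unfolding null_below_def by blast
  have R: "insert x R = S \<union> ((Z - X) \<union> Q)" unfolding R_def using x X by blast
  have X': "X \<subset> Z" "insert x X \<subset> Z" using x X by blast+
  have base: "F X ((Z - X) \<union> Q) = \<tau>"
    using null_below_compl[OF Z X'(1)] unfolding \<tau>_def .
  have 1: "F X (insert x R) = \<tau>"
    unfolding R using insert base by simp
  have "F (insert x X) ((Z - insert x X) \<union> Q) = - \<tau>"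
    using null_below_compl[OF Z X'(2)] X(2) finX unfolding \<tau>_def by simp
  then have 2: "F (insert x X) R = - \<tau>"
    unfolding R_def using absorb_set[of S "insert x X"] insert by auto
  have 3: "F (insert x X) (insert u R) = - \<tau>"
    using absorb[of x "insert x X" u R] 2 insert by auto
  have nt: "(X \<union> R) \<inter> W \<noteq> {}" "(X \<union> insert x (insert u R)) \<inter> W \<noteq> {}"
    "(X \<union> insert x R) \<inter> W \<noteq> {}"
    using Q unfolding R_def by auto
  have "u \<noteq> x" using insert irr by auto
  \<comment> \<open>Selecting and deleting \<open>x\<close> contribute \<open>- \<tau>\<close> and
    \<open>\<tau>\<close> to \<open>F X R\<close>, so the left side vanishes. If \<open>f\<close> is
    the count with both \<open>x\<close> and \<open>u\<close> deleted, what remains is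
    \<open>0 \<le> (f - \<tau>) * \<tau>\<close>, and since \<open>\<tau>\<close> is 1 or -1 and
    \<open>f\<close> has modulus at most 1, \<open>f = \<tau>\<close>.\<close>
  then have "F X R * F X (insert u (insert x R)) \<le> F X (insert u R) * F X (insert x R)"
    using turn[OF nt(1), of u x] by simp
  moreover have "F X R = 0" using split[of X R x] 1 2 by simp
  moreover have 4: "F X (insert u R) = F X (insert u (insert x R)) - \<tau>"
    using split[of X "insert u R" x] 3 by (simp add: insert_commute)
  ultimately have "0 \<le> (F X (insert u (insert x R)) - \<tau>) * \<tau>" using 1 by simp
  moreover have "\<bar>F X (insert u (insert x R))\<bar> \<le> 1" "\<bar>\<tau>\<bar> \<le> 1"
    using bound[OF nt(2)] bound[OF nt(3)] 1 by (simp_all add: insert_commute)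
  moreover have "\<tau> \<noteq> 0" using c unfolding \<tau>_def by simp
  moreover have "\<tau> = 1 \<or> \<tau> = - 1" using calculation by linarith
  ultimately have "F X (insert u (insert x R)) = \<tau>" by auto
  then show ?case using R base by simp
qed simp

text \<open>Selecting a vertex is the difference of the counts without and with its deletion, so a
  count that does not notice deletions from \<open>T\<close> vanishes once something in
  \<open>T\<close> is selected.\<close>

lemma const_in_zero:
  assumes "\<And>S. S \<subseteq> T \<Longrightarrow> F X (S \<union> R) = k"
    and "finite S" "S \<noteq> {}" "S \<subseteq> T" "S' \<subseteq> T"
  shows "F (S \<union> X) (S' \<union> R) = 0"
  using assms(2-5)
proof (induction S arbitrary: S' rule: finite_ne_induct)
  case (singleton u)
  then show ?case using split[of X "S' \<union> R" u] assms(1)[of S'] assms(1)[of "insert u S'"] by simp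
next
  case (insert u S)
  then show ?case
    using split[of "S \<union> X" "S' \<union> R" u] insert.IH[of S'] insert.IH[of "insert u S'"] by simp
qed

lemma shield_in:
  assumes Z: "null_below Z Q" and c: "F {} (Z \<union> Q) \<noteq> 0" and Q: "Q \<inter> W \<noteq> {}"
    and x: "x \<in> Z" and X: "X \<subseteq> Z" "x \<notin> X" "insert x X \<noteq> Z"
    and S: "finite S" "S \<noteq> {}" "\<And>u. u \<in> S \<Longrightarrow> E x u"
  shows "F (S \<union> X) ((Z - X) \<union> Q) = 0"
proof -
  have "F X (S' \<union> ((Z - X) \<union> Q)) = F X ((Z - X) \<union> Q)" if "S' \<subseteq> S" for S'
    using shield[OF Z c Q x X] S that by (meson finite_subset subsetD)
  from const_in_zero[OF this S(1,2) order_refl empty_subsetI]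
  show ?thesis by simp
qed

text \<open>Members of \<open>Z - {x}\<close> outside \<open>X\<close> and \<open>R\<close> are
  undecided; splitting on each of them reduces to a full partition of \<open>Z\<close>, where
  \<open>shield_in\<close> applies. There the deletion of \<open>x\<close> is absorbed by
  \<open>S\<close>, and \<open>R \<noteq> {}\<close> keeps a member besides \<open>x\<close>
  deleted.\<close>

lemma shield_partial:
  assumes Z: "null_below Z Q" and c: "F {} (Z \<union> Q) \<noteq> 0" and Q: "Q \<inter> W \<noteq> {}"
    and x: "x \<in> Z" and S: "finite S" "S \<noteq> {}" "\<And>u. u \<in> S \<Longrightarrow> E x u"
    and X: "X \<subseteq> Z - {x}" "R \<subseteq> Z - {x} - X" "R \<noteq> {}"
  shows "F (S \<union> X) (R \<union> Q) = 0"
  using X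
proof (induction "card (Z - {x} - X - R)" arbitrary: X R rule: less_induct)
  case less
  have fin: "finite (Z - {x} - X - R)" using Z unfolding null_below_def by blast
  show ?case
  proof (cases "Z - {x} - X - R = {}")
    case True
    then have R: "Z - X = insert x R" using less.prems x by blast
    obtain u where "u \<in> S" "E u x" using S sym by blast
    then have "F (S \<union> X) (R \<union> Q) = F (S \<union> X) ((Z - X) \<union> Q)"
      using absorb[of u "S \<union> X" x "R \<union> Q"] R by simp
    also have "\<dots> = 0"
      using less.prems by (intro shield_in[OF Z c Q x _ _ _ S]) blast+
    finally show ?thesis .
  next
    case False
    then obtain a where a: "a \<in> Z - {x} - X - R" by blast
    have "Z - {x} - insert a X - R \<subset> Z - {x} - X - R"
         "Z - {x} - X - insert a R \<subset> Z - {x} - X - R" using a by blast+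
    then have "card (Z - {x} - insert a X - R) < card (Z - {x} - X - R)"
      "card (Z - {x} - X - insert a R) < card (Z - {x} - X - R)"
      using fin by (metis psubset_card_mono)+
    then have "F (S \<union> insert a X) (R \<union> Q) = 0" "F (S \<union> X) (insert a R \<union> Q) = 0"
      using less.prems a by (intro less.hyps; blast)+
    then show ?thesis using split[of "S \<union> X" "R \<union> Q" a] by simp
  qed
qed

text \<open>Once a neighbour of \<open>x\<close> is selected, deleting a further member of the
  circuit gives 0 by \<open>shield_partial\<close>, so selecting that member costs nothing.\<close>

lemma shield_extend:
  assumes Z: "null_below Z Q" and c: "F {} (Z \<union> Q) \<noteq> 0" and Q: "Q \<inter> W \<noteq> {}"
    and x: "x \<in> Z" and S: "finite S" "S \<noteq> {}" "\<And>u. u \<in> S \<Longrightarrow> E x u"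
    and X: "X \<subseteq> Z - {x}"
  shows "F (S \<union> X) Q = F S Q"
proof -
  have "finite X" using Z X finite_subset unfolding null_below_def by blast
  then show ?thesis using X
  proof (induction X)
    case (insert a X)
    have "F (S \<union> X) ({a} \<union> Q) = 0"
      using insert by (intro shield_partial[OF Z c Q x S]) auto
    then show ?case using split[of "S \<union> X" Q a] insert by simp
  qed simp
qed

text \<open>The circuit \<open>Z\<close> turns counts with \<open>s\<close> deleted into counts with
  \<open>T\<close> selected; minimality of \<open>U\<close> then gives a zero count for
  \<open>Y\<close> and a nonzero one for \<open>P\<close>, so deleting their difference
  \<open>w\<close> must matter. Shielding by \<open>U\<close> says that it does not. The
  cardinalities make \<open>T\<close> and \<open>Y\<close> nonempty.\<close>

lemma double_circuit:
  assumes Z: "null_below Z {s}" "F {} (Z \<union> {s}) \<noteq> 0" "\<And>z. z \<in> Z \<Longrightarrow> E s z"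
    and U: "null_below U {x}" "F {} (U \<union> {x}) \<noteq> 0" "\<And>u. u \<in> U \<Longrightarrow> E x u"
    and mem: "x \<in> Z" "s \<in> U" "s \<in> W" "x \<in> W" and card: "card Z \<ge> 2" "card U \<ge> 3"
  shows False
proof -
  have finZ: "finite Z" and finU: "finite U"
    using Z(1) U(1) unfolding null_below_def by auto
  define T where "T = Z - {x}"
  define P where "P = U - {s}"
  have "card T \<ge> 1" "card P \<ge> 2"
    using card mem finZ finU unfolding T_def P_def by (auto simp: card_Diff_singleton_if)
  then have T: "T \<noteq> {}" and P: "P \<noteq> {}" by auto
  then obtain w where w: "w \<in> P" by blast
  define Y where "Y = P - {w}"
  have "card Y \<ge> 1" using w \<open>card P \<ge> 2\<close> finU unfolding Y_def P_def
    by (auto simp: card_Diff_singleton_if)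
  then have Y: "Y \<noteq> {}" by auto
  have fins: "finite T" "finite P" "finite Y" unfolding T_def P_def Y_def using finZ finU by auto
  have nb: "\<And>u. u \<in> P \<Longrightarrow> E x u" "\<And>u. u \<in> Y \<Longrightarrow> E x u" "\<And>z. z \<in> T \<Longrightarrow> E s z"
    using U Z unfolding P_def Y_def T_def by auto
  have xW: "{x} \<inter> W \<noteq> {}" "{s} \<inter> W \<noteq> {}" using mem by auto
  have in_s: "F S {s} = F (S \<union> T) {}" if "finite S" "S \<noteq> {}" "\<And>u. u \<in> S \<Longrightarrow> E x u" for S
  proof -
    have "F S {s} = F (S \<union> T) {s}"
      using shield_extend[OF Z(1,2) xW(2) mem(1) that, of T] unfolding T_def by simp
    also have "\<dots> = F (S \<union> T) {}" using T nb(3) sym absorb[of _ "S \<union> T" s "{}"] by blast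
    finally show ?thesis .
  qed
  have drop_x: "F S {s} = F S ({s} \<union> {x})" if "S \<noteq> {}" "\<And>u. u \<in> S \<Longrightarrow> E x u" for S
    using that sym absorb[of _ S x "{s}"] by (metis all_not_in_conv insert_is_Un insert_commute)
  have "w \<in> U" "w \<notin> Y" "w \<noteq> s" using w unfolding Y_def P_def by auto
  then have "Y \<inter> {s} = {}" "Y \<union> {s} \<subset> U" using mem unfolding Y_def P_def by auto
  then have "F Y ({s} \<union> {x}) = 0" using null_below_part[OF U(1), of "{s}" Y] by simp
  then have 1: "F (Y \<union> T) {} = 0" using in_s[OF fins(3) Y nb(2)] drop_x[OF Y nb(2)] by simp
  have "P \<subset> U" "U - P = {s}" using mem unfolding P_def by auto
  then have "F P ({s} \<union> {x}) \<noteq> 0" using null_below_compl[OF U(1), of P] U(2) by simp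
  then have "F (P \<union> T) {} \<noteq> 0" using in_s[OF fins(2) P nb(1)] drop_x[OF P nb(1)] by simp
  moreover have "P \<union> T = insert w (Y \<union> T)" using w unfolding Y_def by blast
  ultimately have 2: "F (Y \<union> T) {w} \<noteq> 0" using split[of "Y \<union> T" "{}" w] 1 by simp
  \<comment> \<open>Now the roles are exchanged: \<open>T\<close> consists of neighbours of the
    member \<open>s\<close> of \<open>U\<close>. The deletions of \<open>x\<close> and
    \<open>s\<close> are absorbed by \<open>Y\<close> and \<open>T\<close>, which leaves only
    \<open>w\<close>.\<close>
  have "F (T \<union> Y) ((U - Y) \<union> {x}) = 0"
    using w nb(3) by (intro shield_in[OF U(1,2) xW(1) mem(2) _ _ _ fins(1) T])
      (auto simp: Y_def P_def)
  moreover have "(U - Y) \<union> {x} = insert x (insert s {w})"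
    using w mem unfolding Y_def P_def by auto
  moreover have "F (T \<union> Y) (insert x (insert s {w})) = F (T \<union> Y) (insert s {w})"
    using Y nb(2) sym absorb[of _ "T \<union> Y" x] by blast
  moreover have "F (T \<union> Y) (insert s {w}) = F (T \<union> Y) {w}"
    using T nb(3) sym absorb[of _ "T \<union> Y" s] by blast
  ultimately show False using 2 by (simp add: Un_commute)
qed

end

lemma minimal_nonempty:
  assumes "finite N" "N \<noteq> {}" "P N"
  shows "\<exists>M\<subseteq>N. M \<noteq> {} \<and> P M \<and> (\<forall>Y. Y \<noteq> {} \<longrightarrow> Y \<subset> M \<longrightarrow> \<not> P Y)"
  using assms
proof (induction N rule: finite_psubset_induct)
  case (psubset N)
  show ?case
  proof (cases "\<exists>Y. Y \<noteq> {} \<and> Y \<subset> N \<and> P Y")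
    case True
    then obtain Y where Y: "Y \<subset> N" "Y \<noteq> {}" "P Y" by blast
    from psubset.IH[OF this] obtain M
      where "M \<subseteq> Y" "M \<noteq> {} \<and> P M \<and> (\<forall>Y. Y \<noteq> {} \<longrightarrow> Y \<subset> M \<longrightarrow> \<not> P Y)" by blast
    then show ?thesis using Y(1) by (meson psubset_imp_subset subset_trans)
  next
    case False
    then show ?thesis using psubset.prems by blast
  qed
qed

section \<open>The turning inequality for nonadjacent vertices\<close>

text \<open>\<open>A\<close> and \<open>B\<close> are two integer combinations of the counts on \<open>W\<close> and on \<open>W - {t}\<close>, chosen so that a
  failure of the turning inequality at \<open>s\<close> and \<open>t\<close> takes the normal form \<open>out_s\<close>, \<open>in_s\<close>.\<close>
locale twin_sieve =
  A: sieve E W A + B: sieve E W B + AB: sieve E W "\<lambda>X Y. A X Y + B X Y"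
  for E :: "'a \<Rightarrow> 'a \<Rightarrow> bool" and W A B +
  fixes s t :: 'a
  assumes s: "s \<in> W" "s \<noteq> t" "\<not> E s t"
    and turn2: "(X \<union> Y) \<inter> W \<noteq> {} \<Longrightarrow> u \<noteq> t \<Longrightarrow>
      B X (insert u Y) * A X Y \<le> A X (insert u Y) * B X Y"
    and out_s: "A {} {s} = 1" "B {} {s} = 0"
    and in_s: "A {s} {} = 0" "B {s} {} = - 1"
    and nbhd_s: "A {} (nbhd E W s \<union> {s}) = 0" "B {} (nbhd E W s \<union> {s}) = 1"
    and reach: "x \<in> W \<Longrightarrow> E s x \<Longrightarrow> A {x} {} = 1 \<Longrightarrow> B {x} {} = 0 \<Longrightarrow>
      \<exists>Y. Y \<noteq> {} \<and> Y \<subseteq> nbhd E W x - {t} \<and> \<not> (A {} (Y \<union> {x}) = 0 \<and> B {} (Y \<union> {x}) = 0)"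
begin

text \<open>Read as a plane vector, \<open>(A X Y, B X Y)\<close> is zero or one of the six vertices
  of a hexagon. In these terms \<open>turn2\<close> is the sign of a determinant: deleting a vertex
  other than \<open>t\<close> turns a nonzero vector to a nonzero one clockwise, by at most a half
  turn.\<close>

lemma bounds:
  assumes "(X \<union> Y) \<inter> W \<noteq> {}"
  shows "\<bar>A X Y\<bar> \<le> 1" "\<bar>B X Y\<bar> \<le> 1" "\<bar>A X Y + B X Y\<bar> \<le> 1"
  using A.bound[OF assms] B.bound[OF assms] AB.bound[OF assms] .

lemma fin_nbhd: "finite (nbhd E W x)"
  using A.fin unfolding nbhd_def by simp

lemma total: "A {} {} = 1" "B {} {} = - 1"
  using A.split[of "{}" "{}" s] B.split[of "{}" "{}" s] out_s in_s by simp_all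

text \<open>Selecting \<open>s\<close> absorbs \<open>Y\<close>, so deleting \<open>s\<close> after
  \<open>Y\<close> changes the vector by exactly (0, 1). Both vectors lie in the hexagon, and
  \<open>turn2\<close> leaves only the nonpositive values of \<open>A\<close>.\<close>

lemma delete_nbhd_s:
  assumes "Y \<noteq> {}" "Y \<subseteq> nbhd E W s"
  shows "A {} (Y \<union> {s}) = 0 \<and> B {} (Y \<union> {s}) = 0 \<or>
    A {} (Y \<union> {s}) = 0 \<and> B {} (Y \<union> {s}) = 1 \<or> A {} (Y \<union> {s}) = - 1 \<and> B {} (Y \<union> {s}) = 1"
proof -
  have fY: "finite Y" using assms fin_nbhd finite_subset by blast
  have nb: "\<exists>a\<in>{s}. E a y" if "y \<in> Y" for y using assms that unfolding nbhd_def by blast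
  have "A {s} Y = 0" "B {s} Y = - 1"
    using A.absorb_set[OF fY nb, of "{}"] B.absorb_set[OF fY nb, of "{}"] in_s by simp_all
  then have eq: "A {} Y = A {} (insert s Y)" "B {} Y = B {} (insert s Y) - 1"
    using A.split[of "{}" Y s] B.split[of "{}" Y s] by simp_all
  have nt: "({} \<union> Y) \<inter> W \<noteq> {}" "({} \<union> insert s Y) \<inter> W \<noteq> {}"
    using assms s unfolding nbhd_def by auto
  have "B {} (insert s Y) * A {} Y \<le> A {} (insert s Y) * B {} Y"
    using turn2[OF nt(1) s(2)] .
  then have "A {} (insert s Y) \<le> 0" unfolding eq by (simp add: algebra_simps)
  with bounds[OF nt(1)] bounds[OF nt(2)] show ?thesis unfolding eq by simp linarith
qed

text \<open>With \<open>s\<close> already deleted, \<open>turn2\<close> gives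
  \<open>B {} {x, s} \<le> 0\<close>, and of the three vectors in \<open>delete_nbhd_s\<close> only
  zero satisfies this.\<close>

lemma delete_one_s:
  assumes "x \<in> nbhd E W s"
  shows "A {} {x, s} = 0" "B {} {x, s} = 0"
proof -
  have nt: "({} \<union> {s}) \<inter> W \<noteq> {}" "({x} \<union> {s}) \<inter> W \<noteq> {}" using s by auto
  have "x \<noteq> t" using assms s unfolding nbhd_def by blast
  then have "B {} {x, s} \<le> 0" using turn2[OF nt(1), of x] out_s by simp
  moreover have "A {x} {s} = 1 - A {} {x, s}" "B {x} {s} = - B {} {x, s}"
    using A.split[of "{}" "{s}" x] B.split[of "{}" "{s}" x] out_s by simp_all
  ultimately show "A {} {x, s} = 0" "B {} {x, s} = 0"
    using delete_nbhd_s[of "{x}"] bounds[OF nt(2)] assms by (auto simp: insert_commute)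
qed

text \<open>The whole neighbourhood has value (0, 1), so a minimal set with nonzero value exists,
  and \<open>delete_nbhd_s\<close> leaves (0, 1) or (-1, 1). The first is refuted by the bound on
  \<open>A + B\<close> if \<open>card Z\<close> is even and by \<open>turn2\<close> at a member if
  it is odd. The second with \<open>card Z\<close> odd would give
  \<open>A Z {s} = 2\<close>.\<close>

lemma circuit_s:
  obtains Z where "Z \<subseteq> nbhd E W s" "A.null_below Z {s}" "B.null_below Z {s}"
    "A {} (Z \<union> {s}) = - 1" "B {} (Z \<union> {s}) = 1" "even (card Z)" "card Z \<ge> 2"
proof -
  let ?P = "\<lambda>Y. \<not> (A {} (Y \<union> {s}) = 0 \<and> B {} (Y \<union> {s}) = 0)"
  have "nbhd E W s \<noteq> {}" using nbhd_s out_s by auto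
  moreover have "?P (nbhd E W s)" using nbhd_s by simp
  ultimately obtain Z where Z: "Z \<subseteq> nbhd E W s" "Z \<noteq> {}" "?P Z"
    and min: "\<And>Y. Y \<noteq> {} \<Longrightarrow> Y \<subset> Z \<Longrightarrow> \<not> ?P Y"
    using minimal_nonempty[OF fin_nbhd, of s ?P] by metis
  have fZ: "finite Z" using Z fin_nbhd finite_subset by blast
  have nA: "A.null_below Z {s}" and nB: "B.null_below Z {s}"
    unfolding A.null_below_def B.null_below_def using fZ min by blast+
  have card: "card Z \<ge> 2"
  proof (rule ccontr)
    assume "\<not> 2 \<le> card Z"
    moreover have "card Z \<noteq> 0" using Z fZ by simp
    ultimately have "card Z = 1" by linarith
    then obtain x where "Z = {x}" using card_1_singletonE by blast
    then show False using Z delete_one_s[of x] by (simp add: insert_commute)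
  qed
  obtain x where x: "x \<in> Z" using Z by blast
  have sub: "Z - {x} \<subset> Z" "Z - (Z - {x}) = {x}" using x by auto
  have cardx: "card Z = Suc (card (Z - {x}))" using x fZ by (metis card.remove)
  have nt: "(Z \<union> {s}) \<inter> W \<noteq> {}" "((Z - {x}) \<union> {s}) \<inter> W \<noteq> {}" using s by auto
  have full: "A Z {s} = 1 + (- 1) ^ card Z * A {} (Z \<union> {s})"
    "B Z {s} = (- 1) ^ card Z * B {} (Z \<union> {s})"
    using A.null_below_full[OF nA Z(2)] B.null_below_full[OF nB Z(2)] out_s by simp_all
  have part: "A (Z - {x}) {s} = 1" "B (Z - {x}) {s} = 0"
    "A (Z - {x}) {x, s} = (- 1) ^ card (Z - {x}) * A {} (Z \<union> {s})"
    "B (Z - {x}) {x, s} = (- 1) ^ card (Z - {x}) * B {} (Z \<union> {s})"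
    using A.null_below_in[OF nA sub(1)] B.null_below_in[OF nB sub(1)] out_s
      A.null_below_compl[OF nA sub(1)] B.null_below_compl[OF nB sub(1)] sub(2)
    by (simp_all add: insert_commute)
  have "x \<noteq> t" using x Z s unfolding nbhd_def by blast
  then have turn: "B (Z - {x}) {x, s} * A (Z - {x}) {s} \<le> A (Z - {x}) {x, s} * B (Z - {x}) {s}"
    using turn2[OF nt(2), of x] by simp
  have "A {} (Z \<union> {s}) = 0 \<and> B {} (Z \<union> {s}) = 1 \<or> A {} (Z \<union> {s}) = - 1 \<and> B {} (Z \<union> {s}) = 1"
    using delete_nbhd_s[OF Z(2,1)] Z(3) by blast
  then have "A {} (Z \<union> {s}) = - 1 \<and> B {} (Z \<union> {s}) = 1 \<and> even (card Z)"
  proof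
    assume v: "A {} (Z \<union> {s}) = 0 \<and> B {} (Z \<union> {s}) = 1"
    show ?thesis
      by (cases "even (card Z)")
        (use full part turn v cardx bounds[OF nt(1)] in simp_all)
  next
    assume v: "A {} (Z \<union> {s}) = - 1 \<and> B {} (Z \<union> {s}) = 1"
    show ?thesis
      by (cases "even (card Z)") (use full v bounds[OF nt(1)] in simp_all)
  qed
  then show ?thesis using that Z nA nB card by blast
qed

lemma in_circuit_member:
  assumes "x \<in> nbhd E W s"
  shows "A {x} {} = 1" "B {x} {} = 0"
proof -
  have "E x s" using assms A.sym unfolding nbhd_def by blast
  then have "A {x} {s} = A {x} {}" "B {x} {s} = B {x} {}"
    using A.absorb[of x "{x}" s "{}"] B.absorb[of x "{x}" s "{}"] by simp_all
  then show "A {x} {} = 1" "B {x} {} = 0"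
    using A.split[of "{}" "{s}" x] B.split[of "{}" "{s}" x] out_s delete_one_s[OF assms] by simp_all
qed

text \<open>Every other neighbour of a circuit member behaves exactly like \<open>s\<close>.\<close>
lemma second_nbhd:
  assumes Z: "Z \<subseteq> nbhd E W s" "A.null_below Z {s}" "B.null_below Z {s}"
    "A {} (Z \<union> {s}) = - 1" "B {} (Z \<union> {s}) = 1" "even (card Z)" "card Z \<ge> 2"
    and x: "x \<in> Z" and u: "u \<in> nbhd E W x" "u \<noteq> t"
  shows "A {u} {} = 0" "B {u} {} = - 1"
proof -
  have "A {u} {} = 0 \<and> B {u} {} = - 1"
  proof (cases "u = s")
    case True
    then show ?thesis using in_s by simp
  next
    case False
    define T where "T = Z - {x}"
    have fZ: "finite Z" using Z(2) unfolding A.null_below_def by blast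
    have "card T \<ge> 1" using Z(7) x fZ unfolding T_def by (simp add: card_Diff_singleton_if)
    then have "T \<noteq> {}" by auto
    moreover have "T \<subset> Z" "Z - T = {x}" "T \<subseteq> Z - {x}" using x unfolding T_def by auto
    ultimately have T: "T \<noteq> {}" "T \<subset> Z" "Z - T = {x}" "T \<subseteq> Z - {x}" .
    have oddT: "odd (card T)"
      using Z(6) x fZ unfolding T_def by (metis card.remove even_Suc)
    have uW: "u \<in> W" and xu: "E x u" and ux: "E u x" and xn: "x \<in> nbhd E W s"
      using u x Z A.sym unfolding nbhd_def by auto
    have ux': "u \<noteq> x" using xu A.irr by blast
    have nt: "\<And>X Y. (X \<union> insert s Y) \<inter> W \<noteq> {}" "\<And>X Y. (X \<union> insert u Y) \<inter> W \<noteq> {}"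
      "\<And>X Y. (insert s X \<union> Y) \<inter> W \<noteq> {}" "\<And>X Y. (insert u X \<union> Y) \<inter> W \<noteq> {}"
      using s uW by auto
    have sW: "{s} \<inter> W \<noteq> {}" using s by auto
    have Anz: "A {} (Z \<union> {s}) \<noteq> 0" and Bnz: "B {} (Z \<union> {s}) \<noteq> 0" using Z by simp_all
    have S: "finite {u}" "{u} \<noteq> {}" "\<And>w. w \<in> {u} \<Longrightarrow> E x w" using xu by auto
    \<comment> \<open>Shielding lets \<open>T\<close> be selected along with \<open>u\<close> at no
      cost, which carries the values of the circuit over to \<open>u\<close>.\<close>
    have ext: "A (insert u T) {s} = A {u} {s}" "B (insert u T) {s} = B {u} {s}"
      using A.shield_extend[OF Z(2) Anz sW x S T(4)] B.shield_extend[OF Z(3) Bnz sW x S T(4)]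
      by simp_all
    have ext': "A (insert u T) {x, s} = A {u} {s}" "B (insert u T) {x, s} = B {u} {s}"
      using A.absorb[of u "insert u T" x "{s}"] B.absorb[of u "insert u T" x "{s}"] ux ext by simp_all
    have Tv: "B T {s} = 0" "A T {x, s} = 1" "B T {x, s} = - 1"
      using B.null_below_in[OF Z(3) T(2)] A.null_below_compl[OF Z(2) T(2)]
        B.null_below_compl[OF Z(3) T(2)] oddT T(3) Z(4,5) out_s by (simp_all add: insert_commute)
    have Tu: "B T {u, s} = - B {u} {s}" "A T {u, x, s} = 1 - A {u} {s}"
      "B T {u, x, s} = - 1 - B {u} {s}"
      using B.split[of T "{s}" u] A.split[of T "{x, s}" u] B.split[of T "{x, s}" u] Tv ext ext'
      by simp_all
    \<comment> \<open>As \<open>T\<close> is odd, the vector for selecting \<open>T\<close> with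
      \<open>x\<close>, \<open>s\<close> deleted is (1, -1), a vertex of the hexagon; this leaves
      \<open>u\<close> so little room that only (0, 0) and (1, 0) remain for selecting
      \<open>u\<close> with \<open>s\<close> deleted.\<close>
    have "B T {s} * B T {u, x, s} \<le> B T {u, s} * B T {x, s}"
      using B.turn[OF nt(1)[of T "{}"] ux'] by simp
    then have "B {u} {s} \<ge> 0" using Tv Tu by simp
    moreover have "B {u} {s} \<le> 0" "A {u} {s} \<ge> 0" "A {u} {s} \<le> 1"
      using bounds[OF nt(2)[of T "{x, s}"]] bounds[OF nt(1)[of "{u}" "{}"]] Tu by simp_all
    ultimately have v: "B {u} {s} = 0" "A {u} {s} = 0 \<or> A {u} {s} = 1" by auto
    define a where "a = A {u, s} {}"
    define b where "b = B {u, s} {}"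
    have us: "A {u} {} = a + A {u} {s}" "B {u} {} = b"
      "A {s} {u} = - a" "B {s} {u} = - 1 - b"
      using A.split[of "{u}" "{}" s] B.split[of "{u}" "{}" s] A.split[of "{s}" "{}" u]
        B.split[of "{s}" "{}" u] v(1) in_s unfolding a_def b_def
      by (simp_all add: insert_commute)
    have out_us: "A {} {s, u} = 1 - A {u} {s}" "B {} {s, u} = 0"
      using A.split[of "{}" "{s}" u] B.split[of "{}" "{s}" u] v(1) out_s
      by (simp_all add: insert_commute)
    have out_u: "A {} {u} = 1 - A {u} {s} - a" "B {} {u} = - 1 - b"
      using A.split[of "{}" "{u}" s] B.split[of "{}" "{u}" s] us out_us by simp_all
    have bs: "\<bar>A {u} {}\<bar> \<le> 1" "\<bar>A {s} {u}\<bar> \<le> 1" "\<bar>B {s} {u}\<bar> \<le> 1" "\<bar>A {s} {u} + B {s} {u}\<bar> \<le> 1"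
      "\<bar>A {} {u}\<bar> \<le> 1" "\<bar>b\<bar> \<le> 1"
      using bounds[OF nt(4)[of "{}" "{}"]] bounds[OF nt(3)[of "{}" "{u}"]] bounds[OF nt(2)[of "{}" "{}"]]
        us by simp_all
    \<comment> \<open>If it were 1, deleting \<open>x\<close> along with \<open>u\<close> would give
      \<open>a + b \<le> - 1\<close>, and \<open>turn2\<close> with \<open>u\<close> selected would
      give \<open>b \<ge> 0\<close>. The only candidate left, \<open>a = - 1\<close> and
      \<open>b = 0\<close>, violates \<open>turn2\<close> with \<open>s\<close> selected.\<close>
    have "A {u} {s} = 0"
    proof (rule ccontr)
      assume "A {u} {s} \<noteq> 0"
      then have v1: "A {u} {s} = 1" using v by blast
      have "A {x} {u} = 1" "B {x} {u} = 0"
        using A.absorb[of x "{x}" u "{}"] B.absorb[of x "{x}" u "{}"] xu in_circuit_member[OF xn]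
        by simp_all
      then have "A {} {x, u} = - 1 - a" "B {} {x, u} = - 1 - b"
        using A.split[of "{}" "{u}" x] B.split[of "{}" "{u}" x] out_u v1 by simp_all
      then have "a + b \<le> - 1"
        using bounds[OF nt(2)[of "{}" "{x}"]] by (simp add: insert_commute)
      moreover have "b \<ge> 0"
        using turn2[OF nt(4)[of "{}" "{}"] s(2)] us v v1 by simp
      moreover have "b + 1 \<le> 0 \<or> a > - 1 \<or> b > 0"
        using turn2[OF nt(3)[of "{}" "{}"] u(2)] us in_s by (auto simp: algebra_simps)
      ultimately show False using bs us v1 by linarith
    qed
    note v0 = this
    have "b \<le> 0" "a \<ge> 0" "a + b \<le> 0" "b \<ge> - 1" using bs us out_u v0 by linarith+
    then have "a = 0 \<and> b = 0 \<or> a = 0 \<and> b = - 1 \<or> a = 1 \<and> b = - 1" by linarith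
    moreover have "\<not> (a = 0 \<and> b = 0)"
    proof
      assume "a = 0 \<and> b = 0"
      then show False
        using turn2[OF nt(2)[of "{}" "{}"] s(2)] out_u out_us v0 by simp
    qed
    moreover have "\<not> (a = 1 \<and> b = - 1)"
    proof
      \<comment> \<open>Deleting \<open>u\<close> and all of \<open>Z\<close> would then give
        \<open>A\<close> the value -2: -1 from deleting \<open>s\<close> as well and -1 from
        selecting it.\<close>
      assume ab: "a = 1 \<and> b = - 1"
      have "A ({u} \<union> {}) (T \<union> {s}) = 0"
        by (rule A.shield_partial[OF Z(2) Anz sW x S _ _ T(1)]) (use T in auto)
      moreover have "insert x (T \<union> {s}) = Z \<union> {s}" using x unfolding T_def by blast
      ultimately have "A {u} (Z \<union> {s}) = 0"
        using A.absorb[of u "{u}" x "T \<union> {s}"] ux by simp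
      then have "A {} (insert s (insert u Z)) = - 1"
        using A.split[of "{}" "Z \<union> {s}" u] Z(4) by (simp add: insert_commute)
      moreover have "A {s} (Z \<union> {u}) = A {s} {u}"
        using Z(1) by (intro A.absorb_set[OF fZ]) (auto simp: nbhd_def)
      ultimately have "A {} (insert u Z) = - 2"
        using A.split[of "{}" "insert u Z" s] us ab by (simp add: insert_commute)
      then show False using bounds(1)[OF nt(2)[of "{}" Z]] by simp
    qed
    ultimately show ?thesis using us v0 by simp
  qed
  then show "A {u} {} = 0" "B {u} {} = - 1" by auto
qed

text \<open>The configuration is impossible: a circuit around \<open>s\<close> and a circuit around one of its
  members \<open>x\<close> that passes through \<open>s\<close> contradict each other.\<close>
lemma contradiction: False
proof -
  obtain Z where Z: "Z \<subseteq> nbhd E W s" "A.null_below Z {s}" "B.null_below Z {s}"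
    "A {} (Z \<union> {s}) = - 1" "B {} (Z \<union> {s}) = 1" "even (card Z)" "card Z \<ge> 2"
    using circuit_s by blast
  then obtain x where x: "x \<in> Z" by fastforce
  have xn: "x \<in> nbhd E W s" using x Z by blast
  then have xW: "x \<in> W" and sx: "E s x" and xs: "E x s" and xt: "x \<noteq> t" and xs': "x \<noteq> s"
    using s A.sym A.irr unfolding nbhd_def by auto
  \<comment> \<open>The vertex \<open>t\<close> is left out because \<open>turn2\<close> and
    \<open>second_nbhd\<close> only speak of vertices other than \<open>t\<close>.\<close>
  define N where "N = nbhd E W x - {t}"
  have sN: "s \<in> N" unfolding N_def nbhd_def using s xs by simp
  have fN: "finite N" unfolding N_def using fin_nbhd by simp
  have in_x: "A {x} {} = 1" "B {x} {} = 0" using in_circuit_member[OF xn] by simp_all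
  have in_u: "A {u} {} = 0" "B {u} {} = - 1" if "u \<in> N" for u
    using second_nbhd[OF Z x, of u] that unfolding N_def by simp_all
  have Nx: "\<exists>a\<in>{x}. E a y" if "y \<in> N" for y using that unfolding N_def nbhd_def by blast
  have in_xY: "A {x} Y = 1" "B {x} Y = 0" if "Y \<subseteq> N" for Y
    using A.absorb_set[of Y "{x}" "{}"] B.absorb_set[of Y "{x}" "{}"] in_x that Nx
      finite_subset[OF that fN] by fastforce+
  have out_x: "A {} {x} = 0" "B {} {x} = - 1"
    using A.split[of "{}" "{}" x] B.split[of "{}" "{}" x] total in_x by simp_all
  have nt: "\<And>X Y. (X \<union> insert x Y) \<inter> W \<noteq> {}" using xW by auto
  \<comment> \<open>The same argument as in \<open>delete_nbhd_s\<close>, with (1, 0) as the vector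
    for selecting \<open>x\<close> where (0, -1) was the one for \<open>s\<close>.\<close>
  have del: "A {} (Y \<union> {x}) = 0 \<and> B {} (Y \<union> {x}) = 0 \<or>
      A {} (Y \<union> {x}) = - 1 \<and> B {} (Y \<union> {x}) = 0 \<or> A {} (Y \<union> {x}) = 0 \<and> B {} (Y \<union> {x}) = - 1"
    if Y: "Y \<noteq> {}" "Y \<subseteq> N" for Y
  proof -
    have nY: "({} \<union> Y) \<inter> W \<noteq> {}" using Y unfolding N_def nbhd_def by auto
    have eq: "A {} Y = A {} (insert x Y) + 1" "B {} Y = B {} (insert x Y)"
      using A.split[of "{}" Y x] B.split[of "{}" Y x] in_xY[OF Y(2)] by simp_all
    have "B {} (insert x Y) \<le> 0"
      using turn2[OF nY xt] unfolding eq by (simp add: algebra_simps)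
    with bounds[OF nY] bounds[OF nt[of "{}" Y]] show ?thesis unfolding eq by simp linarith
  qed
  have del1: "A {} {u, x} = 0" "B {} {u, x} = 0" if "u \<in> N" for u
  proof -
    have "A {} {u} = 1" "B {} {u} = 0"
      using A.split[of "{}" "{}" u] B.split[of "{}" "{}" u] total in_u[OF that] by simp_all
    then show "A {} {u, x} = 0" "B {} {u, x} = 0"
      using A.split[of "{}" "{u}" x] B.split[of "{}" "{u}" x] in_xY[of "{u}"] that
      by (simp_all add: insert_commute)
  qed
  let ?P = "\<lambda>Y. \<not> (A {} (Y \<union> {x}) = 0 \<and> B {} (Y \<union> {x}) = 0)"
  have circ: "A.null_below M {x}" "B.null_below M {x}" "odd (card M)"
    if M: "M \<subseteq> N" "M \<noteq> {}" "?P M" "\<And>Y. Y \<noteq> {} \<Longrightarrow> Y \<subset> M \<Longrightarrow> \<not> ?P Y" for M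
  proof -
    have "finite M" using M(1) fN finite_subset by blast
    then show nA: "A.null_below M {x}" and nB: "B.null_below M {x}"
      unfolding A.null_below_def B.null_below_def using M(4) by blast+
    have full: "A M {x} = (- 1) ^ card M * A {} (M \<union> {x})"
      "B M {x} = (- 1) ^ card M * B {} (M \<union> {x}) - 1"
      using A.null_below_full[OF nA M(2)] B.null_below_full[OF nB M(2)] out_x by simp_all
    show "odd (card M)"
    proof
      assume "even (card M)"
      then show False using full bounds[OF nt[of M "{}"]] del[OF M(2,1)] M(3) by auto
    qed
  qed
  obtain Y where "Y \<noteq> {}" "Y \<subseteq> N" "?P Y" using reach[OF xW sx in_x] unfolding N_def by metis
  then obtain M where "M \<subseteq> Y" and M: "M \<noteq> {}" "?P M" "\<And>Y. Y \<noteq> {} \<Longrightarrow> Y \<subset> M \<Longrightarrow> \<not> ?P Y"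
    using minimal_nonempty[OF finite_subset[OF _ fN], of Y ?P] by metis
  then have MN: "M \<subseteq> N" using \<open>Y \<subseteq> N\<close> by blast
  \<comment> \<open>An exchange argument puts \<open>s\<close> into a circuit around
    \<open>x\<close>. Otherwise \<open>M\<close> avoids \<open>s\<close>; turning at
    \<open>x\<close> and \<open>s\<close> makes the value at \<open>insert s M\<close> nonzero as
    well, and turning at \<open>s\<close> and a member of \<open>M\<close> gives that value the
    wrong sign.\<close>
  have "\<exists>U\<subseteq>N. s \<in> U \<and> ?P U \<and> (\<forall>Y. Y \<noteq> {} \<longrightarrow> Y \<subset> U \<longrightarrow> \<not> ?P Y)"
  proof (rule ccontr)
    assume no: "\<not> ?thesis"
    then have sM: "s \<notin> M" using M MN by metis
    have free: "\<not> ?P (insert s Y)" if "Y \<subset> M" for Y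
    proof
      assume P: "?P (insert s Y)"
      have "insert s Y \<subseteq> N" using that MN sN by blast
      then obtain U where U: "U \<subseteq> insert s Y" "U \<noteq> {}" "?P U"
        "\<forall>Y. Y \<noteq> {} \<longrightarrow> Y \<subset> U \<longrightarrow> \<not> ?P Y"
        using minimal_nonempty[OF finite_subset[OF _ fN], of "insert s Y" ?P] P by (metis insert_not_empty)
      moreover have "U \<subseteq> N" using U(1) \<open>insert s Y \<subseteq> N\<close> by blast
      ultimately have "s \<notin> U" using no by blast
      then have "U \<subset> M" using U(1) that by blast
      then show False using M(3)[OF U(2)] U(3) by blast
    qed
    note cM = circ[OF MN M]
    define c1 where "c1 = A {} (M \<union> {x})"
    define c2 where "c2 = B {} (M \<union> {x})"
    define d1 where "d1 = A {} (insert s M \<union> {x})"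
    define d2 where "d2 = B {} (insert s M \<union> {x})"
    have c: "c1 = - 1 \<and> c2 = 0 \<or> c1 = 0 \<and> c2 = - 1"
      using del[OF M(1) MN] M(2) unfolding c1_def c2_def by blast
    have d: "d1 = 0 \<and> d2 = 0 \<or> d1 = - 1 \<and> d2 = 0 \<or> d1 = 0 \<and> d2 = - 1"
      using del[of "insert s M"] MN sN unfolding d1_def d2_def by blast
    have nM: "({} \<union> M) \<inter> W \<noteq> {}" using M(1) MN unfolding N_def nbhd_def by auto
    have sMN: "insert s M \<subseteq> N" using MN sN by blast
    have out: "A {} M = c1 + 1" "B {} M = c2" "A {} (insert s M) = d1 + 1" "B {} (insert s M) = d2"
      using A.split[of "{}" M x] B.split[of "{}" M x] in_xY[OF MN]
        A.split[of "{}" "insert s M" x] B.split[of "{}" "insert s M" x] in_xY[OF sMN]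
      unfolding c1_def c2_def d1_def d2_def by simp_all
    have ins: "A {} (insert x M) = c1" "B {} (insert x M) = c2"
      "A {} (insert x (insert s M)) = d1" "B {} (insert x (insert s M)) = d2"
      unfolding c1_def c2_def d1_def d2_def by simp_all
    have "d1 \<le> c1" using A.turn[OF nM xs'] unfolding out ins by (simp add: algebra_simps)
    moreover have "d1 + d2 \<le> c1 + c2"
      using AB.turn[OF nM xs'] unfolding out ins by (simp add: algebra_simps)
    ultimately have d': "d1 = - 1 \<and> d2 = 0 \<or> d1 = 0 \<and> d2 = - 1" using c d by auto
    obtain m where m: "m \<in> M" using M(1) by blast
    have sub: "M - {m} \<subset> M" "M - (M - {m}) = {m}" using m by auto
    have fM: "finite M" using MN fN finite_subset by blast
    have "even (card (M - {m}))" using cM(3) m fM by (metis card.remove even_Suc)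
    \<comment> \<open>By \<open>free\<close>, \<open>M\<close> stays a circuit when \<open>s\<close>
      is deleted too, so the counts with and without \<open>s\<close> can be compared on the same
      set.\<close>
    have nb: "A.null_below M {s, x}" "B.null_below M {s, x}"
      unfolding A.null_below_def B.null_below_def using fM free
      by (simp_all add: insert_commute[of s x])
    have vals: "A (M - {m}) {x} = 0" "B (M - {m}) {x} = - 1"
      "A (M - {m}) {s, x} = 0" "B (M - {m}) {s, x} = 0"
      "A (M - {m}) (insert m {s, x}) = d1" "B (M - {m}) (insert m {s, x}) = d2"
      using A.null_below_in[OF cM(1) sub(1)] B.null_below_in[OF cM(2) sub(1)] out_x
        A.null_below_in[OF nb(1) sub(1)] B.null_below_in[OF nb(2) sub(1)] del1[OF sN]
        A.null_below_compl[OF nb(1) sub(1)] B.null_below_compl[OF nb(2) sub(1)] sub(2)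
        \<open>even (card (M - {m}))\<close> unfolding d1_def d2_def by (simp_all add: insert_commute)
    have "m \<noteq> s" using m sM by blast
    from B.turn[OF nt[of "M - {m}" "{}"] this] have "d2 \<ge> 0" using vals by simp
    moreover from AB.turn[OF nt[of "M - {m}" "{}"] \<open>m \<noteq> s\<close>] have "d1 + d2 \<ge> 0" using vals by simp
    ultimately show False using d' by linarith
  qed
  then obtain U where U: "U \<subseteq> N" "s \<in> U" "?P U"
    and Umin: "\<And>Y. Y \<noteq> {} \<Longrightarrow> Y \<subset> U \<Longrightarrow> \<not> ?P Y" by metis
  have Une: "U \<noteq> {}" using U by blast
  note cU = circ[OF U(1) Une U(3) Umin]
  have "card U \<noteq> 1"
  proof
    assume "card U = 1"
    then have "U = {s}" using U(2) by (metis card_1_singletonE singletonD)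
    then show False using U(3) del1[OF sN] by (simp add: insert_commute)
  qed
  then have "card U \<ge> 3" using cU(3) by presburger
  have sZ: "\<And>z. z \<in> Z \<Longrightarrow> E s z" and xU: "\<And>u. u \<in> U \<Longrightarrow> E x u"
    using Z(1) U(1) unfolding N_def nbhd_def by auto
  show False
  \<comment> \<open>Both \<open>A\<close> and \<open>B\<close> are nonzero at \<open>Z\<close>, so
    either one that is nonzero at \<open>U\<close> gives the contradiction.\<close>
  proof (cases "A {} (U \<union> {x}) = 0")
    case True
    then have "B {} (U \<union> {x}) \<noteq> 0" using U(3) by blast
    then show False
      using B.double_circuit[OF Z(3) _ sZ cU(2) _ xU x U(2) s(1) xW Z(7) \<open>card U \<ge> 3\<close>] Z(5) by simp
  next
    case False
    then show False
      using A.double_circuit[OF Z(2) _ sZ cU(1) _ xU x U(2) s(1) xW Z(7) \<open>card U \<ge> 3\<close>] Z(4) by simp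
  qed
qed

end

section \<open>The turning inequality for adjacent vertices\<close>

lemma abs_le_one_cases: "\<bar>a::int\<bar> \<le> 1 \<Longrightarrow> a = - 1 \<or> a = 0 \<or> a = 1"
  by linarith

lemma opposite_signs:
  assumes "\<bar>a::int\<bar> \<le> 1" "\<bar>b\<bar> \<le> 1"
  shows "a * b = - 1 \<Longrightarrow> a = - 1 \<and> b = 1 \<or> a = 1 \<and> b = - 1"
    and "a * b \<noteq> - 1 \<Longrightarrow> 0 \<le> a * b"
  using abs_le_one_cases[OF assms(1)] abs_le_one_cases[OF assms(2)] by (elim disjE; simp)+

context sieve
begin

context
  assumes iso: "\<And>u X Y. u \<in> W \<Longrightarrow> u \<notin> X \<Longrightarrow> u \<notin> Y \<Longrightarrow>
      F (insert u X) Y = - F X (Y \<union> nbhd E W u \<union> {u})"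
    and nonadj: "\<And>a b. a \<in> W \<Longrightarrow> b \<in> W \<Longrightarrow> a \<noteq> b \<Longrightarrow> \<not> E a b \<Longrightarrow>
      F {} {} * F {} {a, b} \<le> F {} {a} * F {} {b}"
    and tri: "\<And>a b c. a \<in> W \<Longrightarrow> b \<in> W \<Longrightarrow> c \<in> W \<Longrightarrow> E a b \<Longrightarrow> E b c \<Longrightarrow> \<not> E a c"
begin

text \<open>Deleting \<open>t\<close> or \<open>s\<close> moves the total by \<open>\<tau>\<close>
  in opposite directions, so the bounds force it to be 0. Turning with \<open>s\<close> deleted then
  gives \<open>F {x} {t} = 0\<close>, the bounds leave 0 or \<open>\<tau>\<close> for
  \<open>F {x} {}\<close>, and turning with \<open>x\<close> deleted excludes 0.\<close>

lemma opposite_edge: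
  assumes st: "s \<in> W" "t \<in> W" "E s t" and opp: "F {s} {} * F {t} {} = - 1"
  shows "F {} {} = 0" and "\<And>x. x \<in> W \<Longrightarrow> E s x \<Longrightarrow> x \<noteq> t \<Longrightarrow> F {x} {} = F {t} {}"
proof -
  define \<tau> where "\<tau> = F {t} {}"
  have "({s} \<union> {}) \<inter> W \<noteq> {}" "({t} \<union> {}) \<inter> W \<noteq> {}" using st by auto
  from opposite_signs(1)[OF bound[OF this(1)] bound[OF this(2)] opp]
  have \<tau>: "\<tau> = 1 \<and> F {s} {} = - 1 \<or> \<tau> = - 1 \<and> F {s} {} = 1"
    unfolding \<tau>_def by blast
  then have Fs: "F {s} {} = - \<tau>" by auto
  have nt: "({} \<union> {s}) \<inter> W \<noteq> {}" "({} \<union> {t}) \<inter> W \<noteq> {}" using st by auto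
  have out: "F {} {s} = F {} {} + \<tau>" "F {} {t} = F {} {} - \<tau>"
    using split[of "{}" "{}" s] split[of "{}" "{}" t] Fs unfolding \<tau>_def by simp_all
  show f: "F {} {} = 0" using bound[OF nt(1)] bound[OF nt(2)] out \<tau> by auto
  have "F {t} {s} = \<tau>"
    using absorb[of t "{t}" s "{}"] sym[OF st(3)] unfolding \<tau>_def by simp
  then have st0: "F {} {s, t} = 0"
    using split[of "{}" "{s}" t] out f by (simp add: insert_commute)
  fix x assume x: "x \<in> W" "E s x" "x \<noteq> t"
  have xs: "F {x} {s} = F {x} {}" "F {x} {s, t} = F {x} {t}"
    using absorb[of x "{x}" s] sym[OF x(2)] by simp_all
  have nx: "({} \<union> {x}) \<inter> W \<noteq> {}" "({} \<union> {x, t}) \<inter> W \<noteq> {}" "({t} \<union> {x}) \<inter> W \<noteq> {}"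
    "({x} \<union> {}) \<inter> W \<noteq> {}" using x by auto
  have "F {} {x, s, t} = - F {x} {t}"
    using split[of "{}" "{s, t}" x] st0 xs by simp
  then have "- (\<tau> * F {x} {t}) \<le> 0"
    using turn[OF nt(1) x(3)] out f st0 by (simp add: insert_commute)
  moreover have xt: "F {} {x, t} = - \<tau> - F {x} {t}"
    using split[of "{}" "{t}" x] out f by simp
  moreover have "\<bar>F {} {x, t}\<bar> \<le> 1" using bound[OF nx(2)] by simp
  ultimately have b: "F {x} {t} = 0" using \<tau> by auto
  have "F {x} {} = F {x, t} {}" "F {t} {x} = \<tau> - F {x, t} {}"
    using split[of "{x}" "{}" t] split[of "{t}" "{}" x] b unfolding \<tau>_def
    by (simp_all add: insert_commute)
  then have bd: "\<bar>F {x} {}\<bar> \<le> 1" "\<bar>\<tau> - F {x} {}\<bar> \<le> 1"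
    using bound[OF nx(3)] bound[OF nx(4)] by simp_all
  have "F {x} {} \<noteq> 0"
  proof
    assume 0: "F {x} {} = 0"
    have "s \<noteq> t" using st irr by blast
    have "F {} {x} = 0" "F {} {s, x} = \<tau>" "F {} {t, x} = - \<tau>"
      using split[of "{}" "{}" x] split[of "{}" "{s}" x] f xs out xt b 0
      by (simp_all add: insert_commute)
    then show False using turn[OF nx(1) \<open>s \<noteq> t\<close>] \<tau> by auto
  qed
  then show "F {x} {} = F {t} {}" using bd \<tau> unfolding \<tau>_def by auto
qed

text \<open>Otherwise the inequality for nonadjacent pairs would read
  \<open>0 \<le> F {} {x} * F {} {y}\<close>, a product that \<open>opposite_edge\<close> evaluates
  to -1. Absence of triangles keeps \<open>x\<close> and \<open>y\<close> distinct.\<close>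

lemma opposite_edge_complete:
  assumes st: "s \<in> W" "t \<in> W" "E s t" and opp: "F {s} {} * F {t} {} = - 1"
    and x: "x \<in> W" "E s x" "x \<noteq> t" and y: "y \<in> W" "E t y" "y \<noteq> s"
  shows "E x y"
proof (rule ccontr)
  assume no: "\<not> E x y"
  have opp': "F {t} {} * F {s} {} = - 1" using opp by (simp add: mult.commute)
  have "F {x} {} = F {t} {}" by (rule opposite_edge(2)[OF st opp x])
  moreover have "F {y} {} = F {s} {}" by (rule opposite_edge(2)[OF st(2,1) sym[OF st(3)] opp' y])
  moreover have "F {} {} = 0" by (rule opposite_edge(1)[OF st opp])
  ultimately have f: "F {} {} = 0" and "F {} {x} = - F {t} {}" "F {} {y} = - F {s} {}"
    using split[of "{}" "{}" x] split[of "{}" "{}" y] by linarith+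
  then have "F {} {x} * F {} {y} = - 1" using opp' by simp
  moreover have "x \<noteq> y" using tri[OF st(1) x(1) st(2) x(2)] st y sym by blast
  ultimately show False using nonadj[OF x(1) y(1) _ no] f by simp
qed

text \<open>The edge between \<open>y\<close> and \<open>t\<close> is opposite too, and completeness
  for it puts every neighbour of \<open>y\<close> next to \<open>s\<close>. With \<open>s\<close>
  selected, toggling \<open>y\<close> therefore cancels everything, so
  \<open>F {s} {} = 0\<close>.\<close>

lemma no_opposite_edge:
  assumes st: "s \<in> W" "t \<in> W" "E s t" and y: "y \<in> W" "E t y" "y \<noteq> s"
  shows "F {s} {} * F {t} {} \<noteq> - 1"
proof
  assume opp: "F {s} {} * F {t} {} = - 1"
  then have opp': "F {t} {} * F {s} {} = - 1" by (simp add: mult.commute)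
  have "F {y} {} = F {s} {}" by (rule opposite_edge(2)[OF st(2,1) sym[OF st(3)] opp' y])
  then have oppy: "F {y} {} * F {t} {} = - 1" using opp by simp
  have yt: "E y t" using sym y by blast
  have "y \<notin> {s}" using y by blast
  from iso[OF y(1) this] have "F {s, y} {} = - F {s} (nbhd E W y \<union> {y})"
    by (simp add: insert_commute)
  moreover have "F {s} (nbhd E W y \<union> {y}) = F {s} {y}"
  proof (rule absorb_set)
    show "finite (nbhd E W y)" using fin unfolding nbhd_def by simp
    fix z assume z: "z \<in> nbhd E W y"
    have "E s z"
    proof (cases "z = t")
      case False
      then have "E z s"
        using opposite_edge_complete[OF y(1) st(2) yt oppy _ _ False st(1) sym[OF st(3)]] z y(3)
        unfolding nbhd_def by blast
      then show ?thesis by (rule sym)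
    qed (use st in simp)
    then show "\<exists>a\<in>{s}. E a z" by blast
  qed
  ultimately have "F {s} {} = 0" using split[of "{s}" "{}" y] by (simp add: insert_commute)
  then show False using opp by simp
qed

text \<open>On an edge the inequality amounts to \<open>F {s} {} * F {t} {} \<ge> 0\<close>. If the
  edge is a component by itself, toggling gives both factors the same value.\<close>

lemma turn_adjacent:
  assumes st: "s \<in> W" "t \<in> W" "E s t"
  shows "F {} {} * F {} {s, t} \<le> F {} {s} * F {} {t}"
proof -
  have ts: "E t s" using st sym by blast
  have "F {t} {s} = F {t} {}" using absorb[of t "{t}" s "{}"] ts by simp
  then have out: "F {} {s} = F {} {} - F {s} {}" "F {} {t} = F {} {} - F {t} {}"
    "F {} {s, t} = F {} {} - F {s} {} - F {t} {}"
    using split[of "{}" "{}" s] split[of "{}" "{}" t] split[of "{}" "{s}" t]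
    by (simp_all add: insert_commute)
  have "F {s} {} * F {t} {} \<noteq> - 1"
  proof (cases "(\<exists>y\<in>W. E t y \<and> y \<noteq> s) \<or> (\<exists>y\<in>W. E s y \<and> y \<noteq> t)")
    case True
    then show ?thesis
    proof (elim disjE bexE conjE)
      fix y assume "y \<in> W" "E t y" "y \<noteq> s"
      then show ?thesis by (rule no_opposite_edge[OF st])
    next
      fix y assume "y \<in> W" "E s y" "y \<noteq> t"
      then have "F {t} {} * F {s} {} \<noteq> - 1" by (rule no_opposite_edge[OF st(2,1) ts])
      then show ?thesis by (simp add: mult.commute)
    qed
  next
    case False
    then have "\<And>y. y \<in> W \<Longrightarrow> E t y \<Longrightarrow> y = s" "\<And>y. y \<in> W \<Longrightarrow> E s y \<Longrightarrow> y = t" by blast+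
    then have "nbhd E W s = {t}" "nbhd E W t = {s}" using st ts unfolding nbhd_def by blast+
    then have "F {s} {} = F {t} {}"
      using iso[OF st(1), of "{}" "{}"] iso[OF st(2), of "{}" "{}"] by (simp add: insert_commute)
    then have "F {s} {} * F {t} {} \<ge> 0" by simp
    then show ?thesis by linarith
  qed
  moreover have nt: "({s} \<union> {}) \<inter> W \<noteq> {}" "({t} \<union> {}) \<inter> W \<noteq> {}" using st by auto
  ultimately have "F {s} {} * F {t} {} \<ge> 0"
    using opposite_signs(2)[OF bound[OF nt(1)] bound[OF nt(2)]] by linarith
  then show ?thesis unfolding out by (simp add: algebra_simps)
qed

end
end

section \<open>Sieves of total 2\<close>

text \<open>A failure of the bound, up to sign. Two vertices \<open>a\<close>, \<open>b\<close> of
  \<open>W\<close> count as equivalent if \<open>F {a, b} {} = 1\<close>, the only alternative being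
  0.\<close>

locale critical = sieve +
  assumes total: "F {} {} = 2"
    and nonempty: "W \<noteq> {}"
    and iso: "\<And>u. u \<in> W \<Longrightarrow> F {u} {} = - F {} (nbhd E W u \<union> {u})"
begin

lemma single:
  assumes "u \<in> W"
  shows "F {u} {} = 1" "F {} {u} = 1"
proof -
  have nt: "({u} \<union> {}) \<inter> W \<noteq> {}" "({} \<union> {u}) \<inter> W \<noteq> {}" using assms by auto
  show "F {u} {} = 1" "F {} {u} = 1"
    using bound[OF nt(1)] bound[OF nt(2)] split[of "{}" "{}" u] total by linarith+
qed

lemma out_of:
  assumes "u \<in> W"
  shows "F {u} {w} = 1 - F {u, w} {}"
  using split[of "{u}" "{}" w] single[OF assms] by (simp add: insert_commute)

lemma pair_cases:
  assumes "u \<in> W"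
  shows "F {u, w} {} = 0 \<or> F {u, w} {} = 1"
proof -
  have nt: "({u} \<union> {w}) \<inter> W \<noteq> {}" "({u, w} \<union> {}) \<inter> W \<noteq> {}" using assms by auto
  show ?thesis using bound[OF nt(1)] bound[OF nt(2)] out_of[OF assms, of w] by linarith
qed

lemma edge_out:
  assumes "E u w" "u \<in> W" "w \<in> W"
  shows "F {} {u, w} = 0"
proof -
  have "F {u} {w} = F {u} {}" using absorb[of u "{u}" w "{}"] assms by simp
  then show ?thesis using split[of "{}" "{w}" u] single assms by simp
qed

section \<open>Circuits in a critical sieve\<close>

definition circuit :: "'a set \<Rightarrow> 'a \<Rightarrow> bool" where
  "circuit Z v \<longleftrightarrow> Z \<subseteq> nbhd E W v \<and> null_below Z {v} \<and> F {} (Z \<union> {v}) \<noteq> 0 \<and> card Z \<ge> 3"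

text \<open>By \<open>iso\<close>, deleting the whole neighbourhood has nonzero value, so circuits
  exist, and the exchange argument by turning yields one through \<open>x\<close>. Its size is even;
  size 2 is impossible since equivalence of \<open>x\<close> with the other member \<open>w\<close>
  makes \<open>F {} {x, w}\<close> equal 1 instead of 0.\<close>

lemma circuit_through:
  assumes v: "v \<in> W" "x \<in> W" "E v x" and eq: "\<And>w. w \<in> W \<Longrightarrow> E v w \<Longrightarrow> F {x, w} {} = 1"
  shows "\<exists>Z. circuit Z v \<and> x \<in> Z"
proof -
  define N where "N = nbhd E W v"
  have xN: "x \<in> N" unfolding N_def nbhd_def using v by simp
  have fN: "finite N" unfolding N_def nbhd_def using fin by simp
  have vN: "\<exists>a\<in>{v}. E a y" if "y \<in> N" for y using that unfolding N_def nbhd_def by blast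
  have in_v: "F {v} Y = 1" if "Y \<subseteq> N" for Y
    using absorb_set[of Y "{v}" "{}"] single(1)[OF v(1)] that vN finite_subset[OF that fN] by fastforce
  have nt: "\<And>X Y. (X \<union> insert v Y) \<inter> W \<noteq> {}" using v by auto
  have del: "F {} (Y \<union> {v}) = 0 \<or> F {} (Y \<union> {v}) = - 1" and outY: "F {} Y = F {} (Y \<union> {v}) + 1"
    if Y: "Y \<noteq> {}" "Y \<subseteq> N" for Y
  proof -
    have nY: "({} \<union> Y) \<inter> W \<noteq> {}" using Y unfolding N_def nbhd_def by auto
    show *: "F {} Y = F {} (Y \<union> {v}) + 1" using split[of "{}" Y v] in_v[OF Y(2)] by simp
    show "F {} (Y \<union> {v}) = 0 \<or> F {} (Y \<union> {v}) = - 1"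
      using bound[OF nY] bound[OF nt[of "{}" Y]] unfolding * by simp linarith
  qed
  have del1: "F {} {u, v} = 0" if "u \<in> N" for u
    using edge_out[of v u] that v(1) unfolding N_def nbhd_def by (simp add: insert_commute)
  let ?P = "\<lambda>Y. F {} (Y \<union> {v}) \<noteq> 0"
  have circ: "null_below M {v}" "even (card M)" "F {} (M \<union> {v}) = - 1"
    if M: "M \<subseteq> N" "M \<noteq> {}" "?P M" "\<And>Y. Y \<noteq> {} \<Longrightarrow> Y \<subset> M \<Longrightarrow> \<not> ?P Y" for M
  proof -
    have "finite M" using M(1) fN finite_subset by blast
    then show n: "null_below M {v}" unfolding null_below_def using M(4) by blast
    show m1: "F {} (M \<union> {v}) = - 1" using del[OF M(2,1)] M(3) by blast
    have "F M {v} = 1 - (- 1) ^ card M"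
      using null_below_full[OF n M(2)] m1 single(2)[OF v(1)] by simp
    then show "even (card M)" using bound[OF nt[of M "{}"]] by (cases "even (card M)") simp_all
  qed
  have "?P N" using iso[OF v(1)] single(1)[OF v(1)] unfolding N_def by simp
  then obtain M where MN: "M \<subseteq> N" and M: "M \<noteq> {}" "?P M" "\<And>Y. Y \<noteq> {} \<Longrightarrow> Y \<subset> M \<Longrightarrow> \<not> ?P Y"
    using minimal_nonempty[OF fN, of ?P] xN by (metis empty_iff)
  have "\<exists>U\<subseteq>N. x \<in> U \<and> ?P U \<and> (\<forall>Y. Y \<noteq> {} \<longrightarrow> Y \<subset> U \<longrightarrow> \<not> ?P Y)"
  proof (rule ccontr)
    assume no: "\<not> ?thesis"
    then have xM: "x \<notin> M" using M MN by metis
    have free: "\<not> ?P (insert x Y)" if "Y \<subset> M" for Y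
    proof
      assume P: "?P (insert x Y)"
      have sub: "insert x Y \<subseteq> N" using that MN xN by blast
      then obtain U where U: "U \<subseteq> insert x Y" "U \<noteq> {}" "?P U"
        "\<forall>Y. Y \<noteq> {} \<longrightarrow> Y \<subset> U \<longrightarrow> \<not> ?P Y"
        using minimal_nonempty[OF finite_subset[OF _ fN], of "insert x Y" ?P] P by (metis insert_not_empty)
      moreover have "U \<subseteq> N" using U(1) sub by blast
      ultimately have "x \<notin> U" using no by blast
      then have "U \<subset> M" using U(1) that by blast
      then show False using M(3)[OF U(2)] U(3) by blast
    qed
    note cM = circ[OF MN M]
    have nM: "({} \<union> M) \<inter> W \<noteq> {}" using M(1) MN unfolding N_def nbhd_def by auto
    have vx: "v \<noteq> x" using v irr by blast
    define d where "d = F {} (insert x M \<union> {v})"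
    have sub': "insert x M \<subseteq> N" "insert x M \<noteq> {}" using MN xN by auto
    have d: "d = 0 \<or> d = - 1" using del[OF sub'(2,1)] unfolding d_def by simp
    have "F {} M = 0" "F {} (insert v M) = - 1" "F {} (insert x M) = d + 1"
      using outY[OF M(1) MN] outY[OF sub'(2,1)] cM(3) unfolding d_def by simp_all
    then have "d = - 1" using turn[OF nM vx] d by auto
    obtain m where m: "m \<in> M" using M(1) by blast
    have sub: "M - {m} \<subset> M" "M - (M - {m}) = {m}" using m by auto
    have fM: "finite M" using MN fN finite_subset by blast
    have odd: "odd (card (M - {m}))" using cM(2) m fM by (metis card.remove even_Suc)
    have nb: "null_below M {x, v}"
      unfolding null_below_def using fM free by (simp add: insert_commute)
    have "F (M - {m}) {v} = 1" "F (M - {m}) {m, v} = 1"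
      using null_below_in[OF cM(1) sub(1)] null_below_compl[OF cM(1) sub(1)] cM(3) sub(2) odd
        single(2)[OF v(1)] by (simp_all add: insert_commute)
    moreover have "F (M - {m}) {x, v} = 0" "F (M - {m}) {m, x, v} = 1"
      using null_below_in[OF nb sub(1)] null_below_compl[OF nb sub(1)] sub(2) odd del1[OF xN]
        \<open>d = - 1\<close> unfolding d_def by (simp_all add: insert_commute)
    moreover have "m \<noteq> x" using m xM by blast
    ultimately show False using turn[OF nt[of "M - {m}" "{}"], of m x] by simp
  qed
  then obtain U where U: "U \<subseteq> N" "x \<in> U" "?P U"
    and Umin: "\<And>Y. Y \<noteq> {} \<Longrightarrow> Y \<subset> U \<Longrightarrow> \<not> ?P Y" by metis
  have Une: "U \<noteq> {}" using U by blast
  note cU = circ[OF U(1) Une U(3) Umin]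
  have "card U \<noteq> 2"
  proof
    assume "card U = 2"
    then obtain w where w: "U = {x, w}" "w \<noteq> x"
      using U(2) by (metis card_2_iff doubleton_eq_iff insertE singletonD)
    then have wW: "w \<in> W" "E v w" using U(1) unfolding N_def nbhd_def by auto
    have "F {} {x, w} = 0" using outY[OF Une U(1)] cU(3) w by simp
    moreover have "F {} {x, w} = 1 - (1 - F {x, w} {})"
      using split[of "{}" "{w}" x] out_of[OF v(2), of w] single(2)[OF wW(1)] by simp
    ultimately show False using eq[OF wW] by simp
  qed
  moreover have "card U \<noteq> 0" using Une finite_subset[OF U(1) fN] by simp
  ultimately have "card U \<ge> 3" using cU(2) by presburger
  then have "circuit U v" unfolding circuit_def using U cU unfolding N_def by blast
  then show ?thesis using U by blast
qed

text \<open>This transfers the hypothesis of \<open>circuit_through\<close> from \<open>v\<close> to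
  \<open>x\<close>. If \<open>u\<close> were not equivalent to \<open>v\<close>, shielding would
  make it equivalent to another member \<open>y\<close>, and turning at \<open>x\<close> and
  \<open>y\<close> with \<open>u\<close> deleted would fail.\<close>

lemma circuit_member_nbhd:
  assumes Z: "circuit Z v" "x \<in> Z" "v \<in> W" and eq: "\<And>w. w \<in> W \<Longrightarrow> E v w \<Longrightarrow> F {x, w} {} = 1"
    and u: "u \<in> W" "E x u"
  shows "F {v, u} {} = 1"
proof (rule ccontr)
  assume "F {v, u} {} \<noteq> 1"
  then have uv: "F {u} {v} = 1" using pair_cases[OF Z(3), of u] out_of[OF u(1), of v]
    by (auto simp: insert_commute)
  have Z': "null_below Z {v}" "F {} (Z \<union> {v}) \<noteq> 0" "Z \<subseteq> nbhd E W v" "card Z \<ge> 3"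
    using Z(1) unfolding circuit_def by auto
  have fZ: "finite Z" using Z'(1) unfolding null_below_def by blast
  have "card (Z - {x}) \<ge> 2" using Z'(4) Z(2) fZ by simp
  then have "Z - {x} \<noteq> {}" by (metis card.empty not_numeral_le_zero)
  then obtain y where y: "y \<in> Z" "y \<noteq> x" by blast
  have W: "x \<in> W" "y \<in> W" "E v y" "E y v" using Z(2) y(1) Z'(3) sym unfolding nbhd_def by auto
  have vW: "{v} \<inter> W \<noteq> {}" using Z by auto
  have "F ({u} \<union> {y}) {v} = F {u} {v}"
    by (rule shield_extend[OF Z'(1,2) vW Z(2)]) (use u y in auto)
  then have uy: "F {y, u} {} = 1"
    using uv absorb[of y "{y, u}" v "{}"] W by (simp add: insert_commute)
  have "F {x, y} {u} = F {x, y} {}" using absorb[of x "{x, y}" u "{}"] u by simp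
  then have "F {y} {x, u} = - 1"
    using split[of "{y}" "{u}" x] out_of[OF W(2), of u] uy eq[OF W(2,3)] by simp
  moreover have "F {} {x, u} = 0" using edge_out u W by simp
  ultimately have "F {} {y, x, u} = 1" using split[of "{}" "{x, u}" y] by simp
  moreover have "({} \<union> {u}) \<inter> W \<noteq> {}" using u by auto
  from turn[OF this y(2)] have "F {} {u} * F {} {y, x, u} \<le> F {} {y, u} * F {} {x, u}" .
  ultimately show False using single(2)[OF u(1)] \<open>F {} {x, u} = 0\<close> by simp
qed

text \<open>Otherwise there are circuits around \<open>v\<close> through \<open>x\<close> and around
  \<open>x\<close> through \<open>v\<close>, which \<open>double_circuit\<close> forbids.\<close>

lemma nbhd_not_uniform:
  assumes v: "v \<in> W" "x \<in> W" "E v x"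
  shows "\<exists>w\<in>W. E v w \<and> F {x, w} {} = 0"
proof (rule ccontr)
  assume "\<not> ?thesis"
  then have eq: "\<And>w. w \<in> W \<Longrightarrow> E v w \<Longrightarrow> F {x, w} {} = 1" using pair_cases[OF v(2)] by blast
  obtain Z where Z: "circuit Z v" "x \<in> Z" using circuit_through[OF v eq] by blast
  obtain U where U: "circuit U x" "v \<in> U"
    using circuit_through[OF v(2,1) sym[OF v(3)] circuit_member_nbhd[OF Z v(1) eq]] by blast
  show False
  proof (rule double_circuit[of Z v U x])
    show "null_below Z {v}" "F {} (Z \<union> {v}) \<noteq> 0" "null_below U {x}" "F {} (U \<union> {x}) \<noteq> 0"
      "card U \<ge> 3" "card Z \<ge> 2" using Z(1) U(1) unfolding circuit_def by auto
    show "\<And>z. z \<in> Z \<Longrightarrow> E v z" "\<And>u. u \<in> U \<Longrightarrow> E x u"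
      using Z(1) U(1) unfolding circuit_def nbhd_def by auto
  qed (use Z U v in auto)
qed

text \<open>If \<open>a\<close> and \<open>d\<close> were inequivalent, absorption along the walk
  would give \<open>F {} {a, b, c, d} = - 2\<close>.\<close>

lemma four_walk:
  assumes W: "a \<in> W" "b \<in> W" "c \<in> W" "d \<in> W" and E: "E a b" "E b c" "E c d"
    and diff: "F {a, c} {} = 0" "F {b, d} {} = 0"
  shows "F {a, d} {} = 1"
proof (rule ccontr)
  assume "F {a, d} {} \<noteq> 1"
  then have "F {a} {d} = 1" using pair_cases[OF W(1), of d] out_of[OF W(1), of d] by auto
  moreover have "F {a, c} {d} = 0" using absorb[of c "{a, c}" d "{}"] E diff by simp
  ultimately have "F {a} {c, d} = 1" using split[of "{a}" "{d}" c] by (simp add: insert_commute)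
  then have 1: "F {a} {b, c, d} = 1" using absorb[of a "{a}" b "{c, d}"] E by simp
  have "F {b} {c, d} = 1"
    using absorb[of b "{b}" c "{d}"] E out_of[OF W(2), of d] diff by simp
  then have "F {} {b, c, d} = - 1"
    using split[of "{}" "{c, d}" b] edge_out[OF E(3) W(3,4)] by simp
  then have "F {} {a, b, c, d} = - 2" using split[of "{}" "{b, c, d}" a] 1 by simp
  moreover have nt: "({} \<union> {a, b, c, d}) \<inter> W \<noteq> {}" using W by auto
  ultimately show False using bound[OF nt] by simp
qed

text \<open>If \<open>a\<close> and \<open>c\<close> were inequivalent, turning with
  \<open>a\<close> deleted would give \<open>F {a, b, c} {} \<ge> 1\<close> and turning with
  \<open>c\<close> selected would give \<open>F {a, b, c} {} \<le> 0\<close>.\<close>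

lemma equal_trans:
  assumes W: "a \<in> W" "b \<in> W" "c \<in> W" and ab: "F {a, b} {} = 1" and bc: "F {b, c} {} = 1"
  shows "F {a, c} {} = 1"
proof (rule ccontr)
  assume "F {a, c} {} \<noteq> 1"
  then have ac: "F {a, c} {} = 0" using pair_cases[OF W(1), of c] by blast
  define x where "x = F {a, b, c} {}"
  have neq: "a \<noteq> b" "b \<noteq> c" using ab bc ac by auto
  have "F {a, b} {c} = 1 - x"
    using split[of "{a, b}" "{}" c] ab unfolding x_def by (simp add: insert_commute)
  then have bac: "F {b} {a, c} = x - 1"
    using split[of "{b}" "{c}" a] out_of[OF W(2), of c] bc by (simp add: insert_commute)
  have "F {} {a, c} = 0"
    using split[of "{}" "{c}" a] out_of[OF W(1), of c] ac single(2)[OF W(3)] by simp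
  moreover from this have "F {} {b, c, a} = 1 - x"
    using split[of "{}" "{a, c}" b] bac by (simp add: insert_commute)
  moreover have "({} \<union> {a}) \<inter> W \<noteq> {}" using W by auto
  from turn[OF this neq(2)] have "F {} {a} * F {} {b, c, a} \<le> F {} {b, a} * F {} {c, a}" .
  ultimately have "x \<ge> 1" using single(2)[OF W(1)] by (simp add: insert_commute)
  have "F {a, c} {b} = - x"
    using split[of "{a, c}" "{}" b] ac unfolding x_def by (simp add: insert_commute)
  moreover have cb: "F {c} {b} = 0" using out_of[OF W(3), of b] bc by (simp add: insert_commute)
  ultimately have "F {c} {a, b} = x"
    using split[of "{c}" "{b}" a] by simp
  moreover have "({c} \<union> {}) \<inter> W \<noteq> {}" using W by auto
  from turn[OF this neq(1)] have "F {c} {} * F {c} {a, b} \<le> F {c} {a} * F {c} {b}" .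
  ultimately have "x \<le> 0" using cb single(1)[OF W(3)] by simp
  with \<open>x \<ge> 1\<close> show False by simp
qed

lemma class_walk:
  "\<exists>v. \<forall>n::nat. v n \<in> W \<and> E (v n) (v (Suc n)) \<and> F {v n, v (Suc (Suc n))} {} = 0"
proof -
  obtain a where a: "a \<in> W" using nonempty by blast
  have "nbhd E W a \<noteq> {}" using iso[OF a] single[OF a] by auto
  then obtain b where b: "b \<in> W" "E a b" unfolding nbhd_def by blast
  \<comment> \<open>The states of the dependent choice are pairs of consecutive vertices, because
    the condition looks two steps back.\<close>
  let ?P = "\<lambda>(n::nat) p. fst p \<in> W \<and> snd p \<in> W \<and> E (fst p) (snd p)"
  let ?Q = "\<lambda>(n::nat) p q. fst q = snd p \<and> F {fst p, snd q} {} = 0"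
  have "\<exists>f. \<forall>n. ?P n (f n) \<and> ?Q n (f n) (f (Suc n))"
  proof (rule dependent_nat_choice)
    show "\<exists>p. ?P 0 p" using a b by (intro exI[of _ "(a, b)"]) simp
    fix p n assume p: "?P n p"
    then obtain w where "w \<in> W" "E (snd p) w" "F {fst p, w} {} = 0"
      using nbhd_not_uniform[of "snd p" "fst p"] sym by blast
    then show "\<exists>q. ?P (Suc n) q \<and> ?Q n p q" using p by (intro exI[of _ "(snd p, w)"]) simp
  qed
  then obtain f where f: "\<And>n. ?P n (f n)" "\<And>n. ?Q n (f n) (f (Suc n))" by blast
  show ?thesis
  proof (intro exI[of _ "fst \<circ> f"] allI)
    fix n
    show "(fst \<circ> f) n \<in> W \<and> E ((fst \<circ> f) n) ((fst \<circ> f) (Suc n)) \<and>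
      F {(fst \<circ> f) n, (fst \<circ> f) (Suc (Suc n))} {} = 0"
      using f(1)[of n] f(2)[of n] f(2)[of "Suc n"] by simp
  qed
qed

text \<open>The walk visits three classes periodically; a shortest directed cycle between
  these classes has no chord, since every edge between the classes is directed.\<close>
lemma induced_cycle_exists: "\<exists>cs. induced_cycle W E cs \<and> 3 dvd length cs"
proof -
  obtain v where walk: "\<forall>n::nat. v n \<in> W \<and> E (v n) (v (Suc n)) \<and> F {v n, v (Suc (Suc n))} {} = 0"
    using class_walk ..
  have v: "v n \<in> W" "E (v n) (v (Suc n))" and diff: "F {v n, v (Suc (Suc n))} {} = 0" for n
    using walk[rule_format, of n] by auto
  define eqv where "eqv a b \<longleftrightarrow> F {a, b} {} = 1" for a b
  have eqv_sym: "eqv a b \<Longrightarrow> eqv b a" for a b unfolding eqv_def by (simp add: insert_commute)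
  have eqv_trans: "eqv a c" if "eqv a b" "eqv b c" "a \<in> W" "b \<in> W" "c \<in> W" for a b c
    using that equal_trans unfolding eqv_def by blast
  have eqv_edge: "\<not> eqv a b" if "E a b" for a b
    using edge[of a "{a, b}" b "{}"] that unfolding eqv_def by simp
  have period: "eqv (v n) (v (n + 3))" for n
    using four_walk[of "v n" "v (Suc n)" "v (Suc (Suc n))" "v (Suc (Suc (Suc n)))"] v diff
    unfolding eqv_def by (simp add: numeral_3_eq_3)
  have period_mult: "eqv (v n) (v (n + 3 * k))" for n k
  proof (induction k)
    case 0
    then show ?case unfolding eqv_def using single(1)[OF v(1)] by simp
  next
    case (Suc k)
    have "eqv (v n) (v (n + 3 * k + 3))" by (rule eqv_trans[OF Suc period v(1) v(1) v(1)])
    then show ?case by (simp add: algebra_simps)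
  qed
  have to_base: "eqv (v (n mod 3)) (v n)" for n
    using period_mult[of "n mod 3" "n div 3"] by simp
  have base: "i = j" if "i < 3" "j < 3" "eqv (v i) (v j)" for i j :: nat
  proof (rule ccontr)
    assume "i \<noteq> j"
    then have "(i, j) \<in> {(0,1),(1,0),(0,2),(2,0),(1,2),(2,1)}" using that by auto
    moreover have "\<not> eqv (v 0) (v 1)" "\<not> eqv (v 1) (v 2)" "\<not> eqv (v 0) (v 2)"
      using eqv_edge v(2)[of 0] v(2)[of 1] diff[of 0] unfolding eqv_def
      by (simp_all add: numeral_2_eq_2)
    ultimately show False using that(3) eqv_sym by auto
  qed
  define C where "C = {w \<in> W. \<exists>i<3. eqv w (v i)}"
  define col where "col w = (THE i. i < 3 \<and> eqv w (v i))" for w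
  have col_eq: "col w = i" if "w \<in> W" "i < 3" "eqv w (v i)" for w i
    unfolding col_def
  proof (rule the_equality)
    fix j assume j: "j < 3 \<and> eqv w (v j)"
    have "eqv (v j) (v i)" using eqv_trans[OF eqv_sym that(3)] j that v by blast
    then show "j = i" using base j that by blast
  qed (use that in blast)
  have col: "col w < 3" "eqv w (v (col w))" "w \<in> W" if "w \<in> C" for w
    using that col_eq unfolding C_def by auto
  have vC: "v n \<in> C" and col_v: "col (v n) = n mod 3" for n
  proof -
    have *: "eqv (v n) (v (n mod 3))" using to_base eqv_sym by blast
    then show "col (v n) = n mod 3" using col_eq v(1) by simp
    have "n mod 3 < 3" by simp
    then show "v n \<in> C" using * v(1) unfolding C_def by blast
  qed
  have col_edge: "col a \<noteq> col b" if "a \<in> C" "b \<in> C" "E a b" for a b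
  proof
    assume eq: "col a = col b"
    have "eqv (v (col a)) b" unfolding eq by (rule eqv_sym[OF col(2)[OF that(2)]])
    from eqv_trans[OF col(2)[OF that(1)] this] have "eqv a b"
      using col(3)[OF that(1)] col(3)[OF that(2)] v(1) by blast
    then show False using eqv_edge that by blast
  qed
  \<comment> \<open>Edges inside \<open>C\<close> join different colours, and of two distinct
    colours modulo 3 one follows the other, so each edge is an arc in one direction.\<close>
  define arc where "arc a b \<longleftrightarrow> a \<in> C \<and> b \<in> C \<and> E a b \<and> col b = Suc (col a) mod 3" for a b
  define closed where "closed cs \<longleftrightarrow> cs \<noteq> [] \<and>
    (\<forall>i<length cs. arc (cs ! i) (cs ! (Suc i mod length cs)))" for cs
  have arc_v: "arc (v n) (v (Suc n))" for n
    unfolding arc_def using vC v(2) col_v by (simp add: mod_Suc_eq)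
  have "\<exists>cs. closed cs"
  proof -
    have "range v \<subseteq> W" using v(1) by blast
    then have "finite (range v)" using fin by (rule finite_subset)
    then have "\<not> inj v" using finite_imageD[of v UNIV] by auto
    then obtain i j where ij: "i < j" "v i = v j"
      unfolding inj_def by (metis linorder_neqE_nat)
    have "closed (map v [i..<j])"
      unfolding closed_def
    proof (intro conjI allI impI)
      show "map v [i..<j] \<noteq> []" using ij by simp
      fix k assume "k < length (map v [i..<j])"
      then have k: "k < j - i" by simp
      show "arc (map v [i..<j] ! k) (map v [i..<j] ! (Suc k mod length (map v [i..<j])))"
      proof (cases "Suc k = j - i")
        case True
        then have "i + k = j - 1" "v j = v (Suc (j - 1))" using ij by auto
        then show ?thesis using True k ij arc_v[of "j - 1"] by simp
      next
        case False
        then show ?thesis using k ij arc_v[of "i + k"] by simp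
      qed
    qed
    then show ?thesis by blast
  qed
  then obtain cs where cs: "closed cs" and min: "\<And>ds. closed ds \<Longrightarrow> length cs \<le> length ds"
    using ex_has_least_nat[of closed _ length] by metis
  define L where "L = length cs"
  have L: "L > 0" using cs unfolding closed_def L_def by simp
  have step: "arc (cs ! i) (cs ! (Suc i mod L))" if "i < L" for i
    using cs that unfolding closed_def L_def by blast
  \<comment> \<open>An arc from position \<open>i\<close> to position \<open>j\<close> closes the
    stretch from \<open>j\<close> round to \<open>i\<close>, of \<open>r + 1\<close> vertices, into
    a closed walk; minimality makes this stretch the whole cycle.\<close>
  have chord: "j = Suc i mod L" if i: "i < L" and j: "j < L" and a: "arc (cs ! i) (cs ! j)" for i j
  proof -
    define r where "r = (i + L - j) mod L"
    have rL: "r < L" unfolding r_def using L by simp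
    have last: "(j + r) mod L = i"
    proof -
      have "(j + r) mod L = (j + (i + L - j)) mod L" unfolding r_def by (simp add: mod_add_right_eq)
      also have "j + (i + L - j) = i + L" using j by simp
      finally show ?thesis using i by simp
    qed
    define ds where "ds = map (\<lambda>k. cs ! ((j + k) mod L)) [0..<Suc r]"
    have len: "length ds = Suc r" unfolding ds_def by simp
    have nth: "ds ! k = cs ! ((j + k) mod L)" if "k < Suc r" for k
      unfolding ds_def using that by (simp del: upt_Suc)
    have "closed ds"
      unfolding closed_def len
    proof (intro conjI allI impI)
      show "ds \<noteq> []" using len by auto
      fix k assume k: "k < Suc r"
      show "arc (ds ! k) (ds ! (Suc k mod Suc r))"
      proof (cases "k = r")
        case True
        then show ?thesis using nth[of r] nth[of 0] last a j by simp
      next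
        case False
        then have "Suc k mod Suc r = Suc k" "Suc k < Suc r" using k by simp_all
        then show ?thesis
          using nth[OF k] nth[of "Suc k"] step[of "(j + k) mod L"] L by (simp add: mod_Suc_eq)
      qed
    qed
    then have "L \<le> Suc r" using min len unfolding L_def by fastforce
    then have "r = L - 1" using rL by simp
    then have "i = (j + (L - 1)) mod L" using last by simp
    then have "Suc i mod L = Suc (j + (L - 1)) mod L" by (simp add: mod_Suc_eq)
    also have "Suc (j + (L - 1)) = j + L" using L by simp
    finally show ?thesis using j by simp
  qed
  have "distinct cs"
    unfolding distinct_conv_nth
  proof (intro allI impI)
    fix i j assume ij: "i < length cs" "j < length cs" "i \<noteq> j"
    show "cs ! i \<noteq> cs ! j"
    proof
      assume eq: "cs ! i = cs ! j"
      \<comment> \<open>The cyclic predecessor of \<open>i\<close>: its arc to position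
        \<open>i\<close> also leads to the equal vertex at position \<open>j\<close>, so
        \<open>chord\<close> identifies the positions.\<close>
      define h where "h = (i + (L - 1)) mod L"
      have h: "h < L" unfolding h_def using L by simp
      have "Suc h mod L = Suc (i + (L - 1)) mod L" unfolding h_def by (simp add: mod_Suc_eq)
      also have "Suc (i + (L - 1)) = i + L" using L by simp
      finally have hi: "Suc h mod L = i" using ij unfolding L_def by simp
      have "arc (cs ! h) (cs ! j)" using step[OF h] hi eq by simp
      then have "j = i" using chord[OF h] ij hi unfolding L_def by blast
      then show False using ij by simp
    qed
  qed
  have inC: "cs ! i \<in> C" if "i < L" for i using step[OF that] unfolding arc_def by blast
  \<comment> \<open>Each arc raises the colour by 1 modulo 3, so returning to the start after
    \<open>L\<close> arcs forces 3 to divide \<open>L\<close>.\<close>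
  have cols: "col (cs ! i) = (col (cs ! 0) + i) mod 3" if "i < L" for i
    using that
  proof (induction i)
    case 0
    then show ?case using col(1)[OF inC[OF L]] by simp
  next
    case (Suc i)
    then have "arc (cs ! i) (cs ! Suc i)" using step[of i] by simp
    then show ?case using Suc unfolding arc_def by (simp add: mod_Suc_eq)
  qed
  have arc_last: "arc (cs ! (L - 1)) (cs ! 0)" using step[of "L - 1"] L by simp
  then have c0: "col (cs ! 0) = Suc (col (cs ! (L - 1))) mod 3" unfolding arc_def by simp
  have cL: "col (cs ! (L - 1)) = (col (cs ! 0) + (L - 1)) mod 3" using cols[of "L - 1"] L by simp
  have "Suc (col (cs ! (L - 1))) mod 3 = Suc (col (cs ! 0) + (L - 1)) mod 3"
    by (subst cL) (rule mod_Suc_eq)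
  also have "Suc (col (cs ! 0) + (L - 1)) = col (cs ! 0) + L" using L by simp
  finally have "(col (cs ! 0) + L) mod 3 = col (cs ! 0) mod 3"
    using c0 col(1)[OF inC[OF L]] by (metis mod_less)
  then have dvd: "3 dvd L" using mod_eq_dvd_iff_nat[of "col (cs ! 0)" "col (cs ! 0) + L" 3] by simp
  have "induced_cycle W E cs"
    unfolding induced_cycle_def L_def[symmetric]
  proof (intro conjI allI impI)
    show "distinct cs" by fact
    show "3 \<le> L" using dvd L by (simp add: dvd_imp_le)
    show "set cs \<subseteq> W"
    proof
      fix w assume "w \<in> set cs"
      then obtain k where "k < L" "w = cs ! k" unfolding L_def in_set_conv_nth by blast
      then show "w \<in> W" using col(3)[OF inC] by simp
    qed
    fix i j assume i: "i < L" and j: "j < L"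
    show "E (cs ! i) (cs ! j) \<longleftrightarrow> j = Suc i mod L \<or> i = Suc j mod L"
    proof
      assume e: "E (cs ! i) (cs ! j)"
      have next_col: "q = Suc p mod 3 \<or> p = Suc q mod 3" if "p < 3" "q < 3" "p \<noteq> q" for p q :: nat
      proof -
        have "p = 0 \<or> p = 1 \<or> p = 2" "q = 0 \<or> q = 1 \<or> q = 2" using that by linarith+
        then show ?thesis using that(3) by (elim disjE) simp_all
      qed
      have "col (cs ! j) = Suc (col (cs ! i)) mod 3 \<or> col (cs ! i) = Suc (col (cs ! j)) mod 3"
        by (rule next_col[OF col(1)[OF inC[OF i]] col(1)[OF inC[OF j]] col_edge[OF inC[OF i] inC[OF j] e]])
      then have "arc (cs ! i) (cs ! j) \<or> arc (cs ! j) (cs ! i)"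
        unfolding arc_def using inC[OF i] inC[OF j] e sym[OF e] by blast
      then show "j = Suc i mod L \<or> i = Suc j mod L"
        using chord[OF i j] chord[OF j i] by blast
    next
      assume "j = Suc i mod L \<or> i = Suc j mod L"
      then have "arc (cs ! i) (cs ! j) \<or> arc (cs ! j) (cs ! i)" using step[OF i] step[OF j] by auto
      then show "E (cs ! i) (cs ! j)" unfolding arc_def using sym by blast
    qed
  qed
  then show ?thesis using dvd unfolding L_def by blast
qed

end

section \<open>Alternating counts of independent sets\<close>

definition alt_sum :: "('a \<Rightarrow> 'a \<Rightarrow> bool) \<Rightarrow> 'a set \<Rightarrow> 'a set \<Rightarrow> 'a set \<Rightarrow> int" where
  "alt_sum E W X Y = (\<Sum>S | indep_set W E S \<and> X \<subseteq> S \<and> S \<inter> Y = {}. (- 1) ^ card S)"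

lemma finite_indep: "finite W \<Longrightarrow> finite {S. indep_set W E S \<and> P S}"
  by (rule finite_subset[of _ "Pow W"]) (auto simp: indep_set_def)

lemma alt_sum_split:
  assumes "finite W"
  shows "alt_sum E W X Y = alt_sum E W (insert u X) Y + alt_sum E W X (insert u Y)"
proof -
  define A where "A = {S. indep_set W E S \<and> insert u X \<subseteq> S \<and> S \<inter> Y = {}}"
  define B where "B = {S. indep_set W E S \<and> X \<subseteq> S \<and> S \<inter> insert u Y = {}}"
  have "{S. indep_set W E S \<and> X \<subseteq> S \<and> S \<inter> Y = {}} = A \<union> B" unfolding A_def B_def by blast
  moreover have "A \<inter> B = {}" unfolding A_def B_def by blast
  moreover have "finite A" "finite B" unfolding A_def B_def by (rule finite_indep[OF assms])+
  ultimately show ?thesis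
    unfolding alt_sum_def A_def[symmetric] B_def[symmetric] by (simp only: sum.union_disjoint)
qed

lemma alt_sum_zero:
  assumes "\<not> (indep_set W E X \<and> X \<inter> Y = {})"
  shows "alt_sum E W X Y = 0"
proof -
  have "{S. indep_set W E S \<and> X \<subseteq> S \<and> S \<inter> Y = {}} = {}"
    using assms unfolding indep_set_def by blast
  then show ?thesis unfolding alt_sum_def by (simp only: sum.empty)
qed

text \<open>Removing \<open>X\<close> from each set is a bijection onto the independent sets of what
  is left after deleting \<open>Y\<close>, \<open>X\<close> and the neighbours of
  \<open>X\<close>.\<close>

lemma alt_sum_reduce:
  assumes W: "finite W" and sym: "\<And>a b. E a b \<Longrightarrow> E b a" and X: "indep_set W E X" "X \<inter> Y = {}"
    and Z: "X \<inter> Z = {}"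
  shows "alt_sum E W X (Y \<union> Z) =
    (- 1) ^ card X * alt_sum E (W - Y - X - {b. \<exists>a\<in>X. E a b}) {} Z"
proof -
  let ?W = "W - Y - X - {b. \<exists>a\<in>X. E a b}"
  have finX: "finite X" using X(1) W finite_subset unfolding indep_set_def by blast
  have "alt_sum E W X (Y \<union> Z) =
    (\<Sum>S | indep_set ?W E S \<and> {} \<subseteq> S \<and> S \<inter> Z = {}. (- 1) ^ card X * (- 1) ^ card S)"
    unfolding alt_sum_def
  proof (rule sum.reindex_bij_witness[of _ "\<lambda>S. S \<union> X" "\<lambda>S. S - X"])
    fix S assume S: "S \<in> {S. indep_set W E S \<and> X \<subseteq> S \<and> S \<inter> (Y \<union> Z) = {}}"
    then show "S - X \<union> X = S" by blast
    show "S - X \<in> {S. indep_set ?W E S \<and> {} \<subseteq> S \<and> S \<inter> Z = {}}"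
      using S unfolding indep_set_def by blast
    have "finite S" using S W finite_subset unfolding indep_set_def by blast
    then have "card S = card X + card (S - X)"
      using S by (metis (no_types, lifting) card_Diff_subset card_mono finX le_add_diff_inverse mem_Collect_eq)
    then show "(- 1) ^ card X * (- 1) ^ card (S - X) = (- 1 :: int) ^ card S"
      by (simp add: power_add)
  next
    fix S assume S: "S \<in> {S. indep_set ?W E S \<and> {} \<subseteq> S \<and> S \<inter> Z = {}}"
    then show "S \<union> X - X = S" unfolding indep_set_def by blast
    show "S \<union> X \<in> {S. indep_set W E S \<and> X \<subseteq> S \<and> S \<inter> (Y \<union> Z) = {}}"
      using S X Z sym unfolding indep_set_def by blast
  qed
  then show ?thesis unfolding alt_sum_def by (simp add: sum_distrib_left)
qed

text \<open>Removing \<open>u\<close> from a set is a sign-reversing bijection onto the sets that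
  avoid \<open>u\<close> and its neighbours.\<close>

lemma alt_sum_toggle:
  assumes W: "finite W" and sym: "\<And>a b. E a b \<Longrightarrow> E b a" and irr: "\<And>a. \<not> E a a"
    and u: "u \<in> W" "u \<notin> X" "u \<notin> Y"
  shows "alt_sum E W (insert u X) Y = - alt_sum E W X (Y \<union> nbhd E W u \<union> {u})"
proof -
  have "alt_sum E W (insert u X) Y =
    (\<Sum>S | indep_set W E S \<and> X \<subseteq> S \<and> S \<inter> (Y \<union> nbhd E W u \<union> {u}) = {}. - ((- 1) ^ card S))"
    unfolding alt_sum_def
  proof (rule sum.reindex_bij_witness[of _ "\<lambda>S. insert u S" "\<lambda>S. S - {u}"])
    fix S assume S: "S \<in> {S. indep_set W E S \<and> insert u X \<subseteq> S \<and> S \<inter> Y = {}}"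
    then show "insert u (S - {u}) = S" by blast
    have S': "S \<subseteq> W" "\<And>a b. a \<in> S \<Longrightarrow> b \<in> S \<Longrightarrow> \<not> E a b" "u \<in> S" "X \<subseteq> S" "S \<inter> Y = {}"
      using S unfolding indep_set_def by auto
    then show "S - {u} \<in> {S. indep_set W E S \<and> X \<subseteq> S \<and> S \<inter> (Y \<union> nbhd E W u \<union> {u}) = {}}"
      using u(2) unfolding indep_set_def nbhd_def by auto
    have "finite S" using S'(1) W by (rule finite_subset)
    then have "card S = Suc (card (S - {u}))" using S'(3) by (rule card.remove)
    then show "- ((- 1) ^ card (S - {u})) = (- 1 :: int) ^ card S" by simp
  next
    fix S assume S: "S \<in> {S. indep_set W E S \<and> X \<subseteq> S \<and> S \<inter> (Y \<union> nbhd E W u \<union> {u}) = {}}"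
    then show "insert u S - {u} = S" by blast
    have S': "S \<subseteq> W" "\<And>a b. a \<in> S \<Longrightarrow> b \<in> S \<Longrightarrow> \<not> E a b" "X \<subseteq> S" "S \<inter> Y = {}"
      "\<And>a. a \<in> S \<Longrightarrow> \<not> E u a"
      using S unfolding indep_set_def nbhd_def by auto
    have "\<not> E a u" if "a \<in> S" for a using S'(5)[OF that] sym[of a u] by blast
    then show "insert u S \<in> {S. indep_set W E S \<and> insert u X \<subseteq> S \<and> S \<inter> Y = {}}"
      using S' u irr[of u] unfolding indep_set_def by auto
  qed
  then show ?thesis unfolding alt_sum_def by (simp add: sum_negf)
qed

lemma alt_sum_outside: "u \<notin> W \<Longrightarrow> alt_sum E W X (insert u Y) = alt_sum E W X Y"
  unfolding alt_sum_def by (rule sum.cong) (auto simp: indep_set_def)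

text \<open>The two statements carried jointly through the induction on \<open>W\<close>. A vertex
  outside \<open>W\<close> makes the second one an equality.\<close>

definition tame :: "('a \<Rightarrow> 'a \<Rightarrow> bool) \<Rightarrow> 'a set \<Rightarrow> bool" where
  "tame E W \<longleftrightarrow> \<bar>alt_sum E W {} {}\<bar> \<le> 1 \<and>
    (\<forall>a b. a \<noteq> b \<longrightarrow> alt_sum E W {} {} * alt_sum E W {} {a, b} \<le> alt_sum E W {} {a} * alt_sum E W {} {b})"

text \<open>When \<open>X \<union> Y\<close> meets \<open>W\<close>, \<open>alt_sum_reduce\<close>
  leads to a proper subset of \<open>W\<close>, where tameness applies; the sign enters the turning
  inequality squared.\<close>

lemma sieve_alt_sum:
  assumes W: "finite W" and sym: "\<And>a b. E a b \<Longrightarrow> E b a" and irr: "\<And>a. \<not> E a a"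
    and IH: "\<And>W'. W' \<subset> W \<Longrightarrow> tame E W'"
  shows "sieve E W (alt_sum E W)"
proof
  show "alt_sum E W X Y = alt_sum E W (insert u X) Y + alt_sum E W X (insert u Y)" for X Y u
    by (rule alt_sum_split[OF W])
  show "alt_sum E W X Y = 0" if "a \<in> X" "b \<in> X" "E a b" for a b X Y
    using that by (intro alt_sum_zero) (auto simp: indep_set_def)
  fix X Y :: "'a set"
  assume nt: "(X \<union> Y) \<inter> W \<noteq> {}"
  define W' where "W' = W - Y - X - {b. \<exists>a\<in>X. E a b}"
  have "W' \<subset> W" using nt unfolding W'_def by blast
  then have tame: "tame E W'" by (rule IH)
  show "\<bar>alt_sum E W X Y\<bar> \<le> 1"
  proof (cases "indep_set W E X \<and> X \<inter> Y = {}")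
    case True
    then have "alt_sum E W X Y = (- 1) ^ card X * alt_sum E W' {} {}"
      using alt_sum_reduce[where E = E and Z = "{}", OF W _ conjunct1[OF True] conjunct2[OF True]] sym
      unfolding W'_def by simp
    then show ?thesis using tame unfolding tame_def by (simp add: abs_mult power_abs)
  qed (simp add: alt_sum_zero)
  fix a b :: 'a assume ab: "a \<noteq> b"
  show "alt_sum E W X Y * alt_sum E W X (insert a (insert b Y)) \<le>
    alt_sum E W X (insert a Y) * alt_sum E W X (insert b Y)"
  proof (cases "indep_set W E X \<and> X \<inter> Y = {} \<and> a \<notin> X \<and> b \<notin> X")
    case True
    have "alt_sum E W X (Y \<union> Z) = (- 1) ^ card X * alt_sum E W' {} Z" if "X \<inter> Z = {}" for Z
      unfolding W'_def by (rule alt_sum_reduce) (use W sym True that in auto)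
    from this[of "{}"] this[of "{a}"] this[of "{b}"] this[of "{a, b}"]
    have eq: "alt_sum E W X Y = (- 1) ^ card X * alt_sum E W' {} {}"
      "alt_sum E W X (insert a Y) = (- 1) ^ card X * alt_sum E W' {} {a}"
      "alt_sum E W X (insert b Y) = (- 1) ^ card X * alt_sum E W' {} {b}"
      "alt_sum E W X (insert a (insert b Y)) = (- 1) ^ card X * alt_sum E W' {} {a, b}"
      using True by simp_all
    have "alt_sum E W' {} {} * alt_sum E W' {} {a, b} \<le> alt_sum E W' {} {a} * alt_sum E W' {} {b}"
      using tame ab unfolding tame_def by blast
    then show ?thesis unfolding eq by (cases "even (card X)") simp_all
  next
    case False
    then have "alt_sum E W X (insert a (insert b Y)) = 0" by (intro alt_sum_zero) auto
    moreover have "alt_sum E W X (insert a Y) = 0 \<or> alt_sum E W X (insert b Y) = 0"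
      using False alt_sum_zero[of W E X "insert a Y"] alt_sum_zero[of W E X "insert b Y"] by auto
    ultimately show ?thesis by auto
  qed
qed (use W sym irr in auto)

section \<open>Operations that preserve sieves\<close>

lemma sieve_neg:
  assumes "sieve E W F"
  shows "sieve E W (\<lambda>X Y. - F X Y)"
proof -
  interpret sieve E W F by fact
  show ?thesis
  proof
    show "- F X Y = - F (insert u X) Y + - F X (insert u Y)" for X Y u using split[of X Y u] by simp
    show "- F X Y = 0" if "a \<in> X" "b \<in> X" "E a b" for a b X Y using edge[OF that] by simp
    show "\<bar>- F X Y\<bar> \<le> 1" if "(X \<union> Y) \<inter> W \<noteq> {}" for X Y using bound[OF that] by simp
    show "- F X Y * - F X (insert a (insert b Y)) \<le> - F X (insert a Y) * - F X (insert b Y)"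
      if "(X \<union> Y) \<inter> W \<noteq> {}" "a \<noteq> b" for X Y a b using turn[OF that] by simp
  qed (use fin sym irr in auto)
qed

lemma sieve_delete:
  assumes "sieve E W F" "t \<in> W"
  shows "sieve E W (\<lambda>X Y. F X (insert t Y))"
proof -
  interpret sieve E W F by fact
  have nt: "(X \<union> insert t Y) \<inter> W \<noteq> {}" for X Y using assms(2) by auto
  show ?thesis
  proof
    show "F X (insert t Y) = F (insert u X) (insert t Y) + F X (insert t (insert u Y))" for X Y u
      using split[of X "insert t Y" u] by (simp add: insert_commute)
    show "F X (insert t Y) = 0" if "a \<in> X" "b \<in> X" "E a b" for a b X Y using edge[OF that] .
    show "\<bar>F X (insert t Y)\<bar> \<le> 1" for X Y using bound[OF nt] .
    show "F X (insert t Y) * F X (insert t (insert a (insert b Y)))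
        \<le> F X (insert t (insert a Y)) * F X (insert t (insert b Y))" if "a \<noteq> b" for X Y a b
      using turn[OF nt[of X Y] that] by (simp add: insert_commute)
  qed (use fin sym irr in auto)
qed

lemma sieve_select:
  assumes "sieve E W F" "t \<in> W"
  shows "sieve E W (\<lambda>X Y. F (insert t X) Y)"
proof -
  interpret sieve E W F by fact
  have nt: "(insert t X \<union> Y) \<inter> W \<noteq> {}" for X Y using assms(2) by auto
  show ?thesis
  proof
    show "F (insert t X) Y = F (insert t (insert u X)) Y + F (insert t X) (insert u Y)" for X Y u
      using split[of "insert t X" Y u] by (simp add: insert_commute)
    show "F (insert t X) Y = 0" if "a \<in> X" "b \<in> X" "E a b" for a b X Y
      using edge[of a "insert t X" b Y] that by simp
    show "\<bar>F (insert t X) Y\<bar> \<le> 1" for X Y using bound[OF nt] .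
    show "F (insert t X) Y * F (insert t X) (insert a (insert b Y))
        \<le> F (insert t X) (insert a Y) * F (insert t X) (insert b Y)" if "a \<noteq> b" for X Y a b
      using turn[OF nt[of X Y] that] .
  qed (use fin sym irr in auto)
qed

text \<open>Let \<open>q\<close>, \<open>p\<close> be the values of \<open>S\<close>,
  \<open>P\<close> with \<open>s\<close> deleted and \<open>q'\<close>, \<open>p'\<close> those with
  \<open>s\<close> selected. A violation says \<open>q * p' < q' * p\<close>, and the bounds leave
  six such configurations, rotations of one another. A change of basis of determinant 1 brings each
  into the form required by \<open>twin_sieve\<close>.\<close>

lemma turn_nonadjacent:
  assumes W: "finite W" and sym: "\<And>a b. E a b \<Longrightarrow> E b a" and irr: "\<And>a. \<not> E a a"
    and IH: "\<And>W'. W' \<subset> W \<Longrightarrow> tame E W'" and b0: "\<bar>alt_sum E W {} {}\<bar> \<le> 1"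
    and st: "s \<in> W" "t \<in> W" "s \<noteq> t" "\<not> E s t"
  shows "alt_sum E W {} {} * alt_sum E W {} {s, t} \<le> alt_sum E W {} {s} * alt_sum E W {} {t}"
proof (rule ccontr)
  assume viol: "\<not> ?thesis"
  define S where "S = alt_sum E W"
  define P where "P X Y = S X (insert t Y)" for X Y
  define R where "R X Y = S (insert t X) Y" for X Y
  interpret S: sieve E W S unfolding S_def by (rule sieve_alt_sum) (use W sym irr IH in auto)
  have sv: "sieve E W S" "sieve E W P" "sieve E W R"
    unfolding P_def R_def
    using S.sieve_axioms sieve_delete[OF S.sieve_axioms st(2)] sieve_select[OF S.sieve_axioms st(2)]
    by simp_all
  have R_eq: "R X Y = S X Y - P X Y" for X Y
    unfolding R_def P_def using S.split[of X Y t] by simp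
  have toggle: "S (insert u X) Y = - S X (Y \<union> nbhd E W u \<union> {u})"
    if "u \<in> W" "u \<notin> X" "u \<notin> Y" for u X Y
    unfolding S_def by (rule alt_sum_toggle) (use W sym irr that in auto)
  define L where "L k l X Y = k * S X Y + l * P X Y" for k l :: int and X Y
  \<comment> \<open>The coefficients for which \<open>k * S + l * P\<close> is, up to sign, one of
    \<open>S\<close>, \<open>P\<close> and \<open>R = S - P\<close>, hence again a sieve.\<close>
  define dirs :: "(int \<times> int) set" where "dirs = {(1, 0), (- 1, 0), (0, 1), (0, - 1), (1, - 1), (- 1, 1)}"
  have L_sieve: "sieve E W (L k l)" if "(k, l) \<in> dirs" for k l
  proof -
    have "L k l = S \<or> L k l = (\<lambda>X Y. - S X Y) \<or> L k l = P \<or> L k l = (\<lambda>X Y. - P X Y) \<or>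
        L k l = R \<or> L k l = (\<lambda>X Y. - R X Y)"
      using that unfolding dirs_def L_def by (auto simp: fun_eq_iff R_eq)
    then show ?thesis
      using sv sieve_neg[OF sv(1)] sieve_neg[OF sv(2)] sieve_neg[OF sv(3)]
      by (elim disjE) (simp_all only:)
  qed
  have no_twin: False
    if dirs: "(a1, a2) \<in> dirs" "(b1, b2) \<in> dirs" "(a1 + b1, a2 + b2) \<in> dirs"
      and det: "a1 * b2 - a2 * b1 = 1"
      and vals: "L a1 a2 {} {s} = 1" "L b1 b2 {} {s} = 0" "L a1 a2 {s} {} = 0" "L b1 b2 {s} {} = - 1"
    for a1 a2 b1 b2
  proof -
    have sum: "(\<lambda>X Y. L a1 a2 X Y + L b1 b2 X Y) = L (a1 + b1) (a2 + b2)"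
      unfolding L_def by (simp add: fun_eq_iff algebra_simps)
    interpret A: sieve E W "L a1 a2" by (rule L_sieve[OF dirs(1)])
    interpret B: sieve E W "L b1 b2" by (rule L_sieve[OF dirs(2)])
    interpret AB: sieve E W "\<lambda>X Y. L a1 a2 X Y + L b1 b2 X Y"
      unfolding sum by (rule L_sieve[OF dirs(3)])
    have tog: "L k l {s} {} = - L k l {} (nbhd E W s \<union> {s})" for k l
      unfolding L_def P_def using toggle[OF st(1), of "{}" "{}"] toggle[OF st(1), of "{}" "{t}"] st(3)
      by (simp add: insert_commute)
    have inv: "S X Y = b2 * L a1 a2 X Y - a2 * L b1 b2 X Y"
      "P X Y = a1 * L b1 b2 X Y - b1 * L a1 a2 X Y" for X Y
    proof -
      have "b2 * L a1 a2 X Y - a2 * L b1 b2 X Y = (a1 * b2 - a2 * b1) * S X Y"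
        "a1 * L b1 b2 X Y - b1 * L a1 a2 X Y = (a1 * b2 - a2 * b1) * P X Y"
        unfolding L_def by (simp_all add: algebra_simps)
      then show "S X Y = b2 * L a1 a2 X Y - a2 * L b1 b2 X Y"
        "P X Y = a1 * L b1 b2 X Y - b1 * L a1 a2 X Y" unfolding det by simp_all
    qed
    have "twin_sieve E W (L a1 a2) (L b1 b2) s t"
    proof
      show "s \<in> W" "s \<noteq> t" "\<not> E s t" by fact+
      show "L a1 a2 {} {s} = 1" "L b1 b2 {} {s} = 0" "L a1 a2 {s} {} = 0" "L b1 b2 {s} {} = - 1"
        by fact+
      show "L a1 a2 {} (nbhd E W s \<union> {s}) = 0" "L b1 b2 {} (nbhd E W s \<union> {s}) = 1"
        using tog[of a1 a2] tog[of b1 b2] vals by simp_all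
      fix X Y :: "'a set" and u assume nt: "(X \<union> Y) \<inter> W \<noteq> {}" and u: "u \<noteq> t"
      \<comment> \<open>Turning at \<open>u\<close> and \<open>t\<close> is the sign of a 2 by 2
        determinant in \<open>S\<close> and \<open>P\<close>, which a change of basis of determinant
        1 preserves.\<close>
      have "S X (insert u Y) * P X Y - P X (insert u Y) * S X Y \<ge> 0"
        using S.turn[OF nt u] unfolding P_def by (simp add: insert_commute mult.commute)
      moreover have "L a1 a2 X (insert u Y) * L b1 b2 X Y - L b1 b2 X (insert u Y) * L a1 a2 X Y =
          (a1 * b2 - a2 * b1) * (S X (insert u Y) * P X Y - P X (insert u Y) * S X Y)"
        unfolding L_def by (simp add: algebra_simps)
      ultimately show "L b1 b2 X (insert u Y) * L a1 a2 X Y \<le> L a1 a2 X (insert u Y) * L b1 b2 X Y"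
        unfolding det by simp
    next
      fix x assume x: "x \<in> W" "E s x" and A1: "L a1 a2 {x} {} = 1"
      \<comment> \<open>All of \<open>N\<close> is a witness for \<open>reach\<close>: if both
        counts vanished there, toggling \<open>x\<close> would give \<open>P {x} {} = 0\<close> and
        \<open>S {x} {} = 0\<close>, against \<open>A1\<close>. If \<open>t\<close> is a neighbour
        of \<open>x\<close>, the second follows from the first by absorption.\<close>
      define N where "N = nbhd E W x - {t}"
      have sN: "s \<in> N" using st x sym unfolding N_def nbhd_def by simp
      have nz: "\<not> (L a1 a2 {} (N \<union> {x}) = 0 \<and> L b1 b2 {} (N \<union> {x}) = 0)"
      proof
        assume "L a1 a2 {} (N \<union> {x}) = 0 \<and> L b1 b2 {} (N \<union> {x}) = 0"
        then have 0: "S {} (N \<union> {x}) = 0" "P {} (N \<union> {x}) = 0"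
          using inv[of "{}" "N \<union> {x}"] by simp_all
        have "x \<noteq> t" using x st by blast
        have "insert t (N \<union> {x}) = {t} \<union> nbhd E W x \<union> {x}" unfolding N_def by blast
        then have Px: "P {x} {} = 0"
          using 0(2) toggle[OF x(1), of "{}" "{t}"] \<open>x \<noteq> t\<close> unfolding P_def by simp
        have "S {x} {} = 0"
        proof (cases "E x t")
          case True
          then show ?thesis using Px S.absorb[of x "{x}" t "{}"] unfolding P_def by simp
        next
          case False
          then have "N = nbhd E W x" unfolding N_def nbhd_def by blast
          then show ?thesis using 0(1) toggle[OF x(1), of "{}" "{}"] by simp
        qed
        then show False using A1 Px unfolding L_def by simp
      qed
      show "\<exists>Y. Y \<noteq> {} \<and> Y \<subseteq> nbhd E W x - {t} \<and>
          \<not> (L a1 a2 {} (Y \<union> {x}) = 0 \<and> L b1 b2 {} (Y \<union> {x}) = 0)"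
      proof (intro exI conjI)
        show "N \<noteq> {}" using sN by auto
        show "N \<subseteq> nbhd E W x - {t}" unfolding N_def by (rule order_refl)
      qed (rule nz)
    qed
    then show False by (rule twin_sieve.contradiction)
  qed
  define p where "p = P {} {s}"
  define q where "q = S {} {s}"
  define p' where "p' = P {s} {}"
  define q' where "q' = S {s} {}"
  have nt: "({} \<union> {s}) \<inter> W \<noteq> {}" "({s} \<union> {}) \<inter> W \<noteq> {}" "({} \<union> {t}) \<inter> W \<noteq> {}"
    "({t} \<union> {}) \<inter> W \<noteq> {}" using st by auto
  have tot: "S {} {} = q + q'" "S {} {t} = p + p'" "S {} {s, t} = p"
    using S.split[of "{}" "{}" s] S.split[of "{}" "{t}" s]
    unfolding p_def q_def p'_def q'_def P_def by (simp_all add: insert_commute)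
  have "S {t} {} = q + q' - (p + p')" using S.split[of "{}" "{}" t] tot by simp
  then have bd: "\<bar>q + q'\<bar> \<le> 1" "\<bar>p + p'\<bar> \<le> 1" "\<bar>q + q' - (p + p')\<bar> \<le> 1"
    using b0 S.bound[OF nt(3)] S.bound[OF nt(4)] tot unfolding S_def[symmetric] by simp_all
  interpret P: sieve E W P by (rule sv)
  interpret R: sieve E W R by (rule sv)
  have bd': "\<bar>q\<bar> \<le> 1" "\<bar>q'\<bar> \<le> 1" "\<bar>p\<bar> \<le> 1" "\<bar>p'\<bar> \<le> 1" "\<bar>q - p\<bar> \<le> 1" "\<bar>q' - p'\<bar> \<le> 1"
    using S.bound[OF nt(1)] S.bound[OF nt(2)] P.bound[OF nt(1)] P.bound[OF nt(2)]
      R.bound[OF nt(1)] R.bound[OF nt(2)]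
    unfolding R_eq p_def q_def p'_def q'_def by simp_all
  have "(q + q') * p > q * (p + p')"
    using viol tot unfolding S_def[symmetric] q_def by simp
  then have v: "q' * p > q * p'" by (simp add: algebra_simps)
  have Lv: "L k l {} {s} = k * q + l * p" "L k l {s} {} = k * q' + l * p'" for k l
    unfolding L_def p_def q_def p'_def q'_def by simp_all
  have "(p = 0 \<and> q = 1 \<and> p' = - 1 \<and> q' = - 1) \<or> (p = 0 \<and> q = - 1 \<and> p' = 1 \<and> q' = 1) \<or>
      (p = 1 \<and> q = 0 \<and> p' = 0 \<and> q' = 1) \<or> (p = - 1 \<and> q = 0 \<and> p' = 0 \<and> q' = - 1) \<or>
      (p = 1 \<and> q = 1 \<and> p' = - 1 \<and> q' = 0) \<or> (p = - 1 \<and> q = - 1 \<and> p' = 1 \<and> q' = 0)"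
    using abs_le_one_cases[OF bd'(1)] abs_le_one_cases[OF bd'(2)] abs_le_one_cases[OF bd'(3)]
      abs_le_one_cases[OF bd'(4)] bd bd'(5,6) v
    by (elim disjE) simp_all
  then show False
  proof (elim disjE)
    assume "p = 0 \<and> q = 1 \<and> p' = - 1 \<and> q' = - 1"
    then show False by (intro no_twin[of 1 "- 1" 0 1]) (simp_all add: Lv dirs_def)
  next
    assume "p = 0 \<and> q = - 1 \<and> p' = 1 \<and> q' = 1"
    then show False by (intro no_twin[of "- 1" 1 0 "- 1"]) (simp_all add: Lv dirs_def)
  next
    assume "p = 1 \<and> q = 0 \<and> p' = 0 \<and> q' = 1"
    then show False by (intro no_twin[of 0 1 "- 1" 0]) (simp_all add: Lv dirs_def)
  next
    assume "p = - 1 \<and> q = 0 \<and> p' = 0 \<and> q' = - 1"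
    then show False by (intro no_twin[of 0 "- 1" 1 0]) (simp_all add: Lv dirs_def)
  next
    assume "p = 1 \<and> q = 1 \<and> p' = - 1 \<and> q' = 0"
    then show False by (intro no_twin[of 1 0 "- 1" 1]) (simp_all add: Lv dirs_def)
  next
    assume "p = - 1 \<and> q = - 1 \<and> p' = 1 \<and> q' = 0"
    then show False by (intro no_twin[of "- 1" 0 1 "- 1"]) (simp_all add: Lv dirs_def)
  qed
qed

section \<open>Ternary graphs\<close>

lemma ternary_subset: "ternary W E \<Longrightarrow> W' \<subseteq> W \<Longrightarrow> ternary W' E"
  unfolding ternary_def induced_cycle_def by blast

lemma ternary_no_triangle:
  assumes W: "ternary W E" and sym: "\<And>a b. E a b \<Longrightarrow> E b a" and irr: "\<And>a. \<not> E a a"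
    and abc: "a \<in> W" "b \<in> W" "c \<in> W" "E a b" "E b c"
  shows "\<not> E a c"
proof
  assume ac: "E a c"
  have "a \<noteq> b" "b \<noteq> c" "a \<noteq> c" using abc ac irr by auto
  moreover have "E ([a, b, c] ! i) ([a, b, c] ! j) \<longleftrightarrow> (j = Suc i mod 3 \<or> i = Suc j mod 3)"
    if "i < 3" "j < 3" for i j
  proof -
    have "i = 0 \<or> i = 1 \<or> i = 2" "j = 0 \<or> j = 1 \<or> j = 2" using that by linarith+
    then show ?thesis using abc ac irr sym[OF abc(4)] sym[OF abc(5)] sym[OF ac] by (elim disjE) simp_all
  qed
  ultimately have "induced_cycle W E [a, b, c]"
    unfolding induced_cycle_def using abc by simp
  moreover have "3 dvd length [a, b, c]" by (simp add: numeral_3_eq_3)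
  ultimately show False using W unfolding ternary_def by blast
qed

text \<open>Splitting at one vertex bounds the modulus by 2, and a total of 2 or -2 makes the count
  or its negative a critical sieve, which contains a forbidden cycle.\<close>

lemma ternary_alt_sum_bound:
  assumes W: "finite W" and sym: "\<And>a b. E a b \<Longrightarrow> E b a" and irr: "\<And>a. \<not> E a a"
    and IH: "\<And>W'. W' \<subset> W \<Longrightarrow> tame E W'" and ter: "ternary W E"
  shows "\<bar>alt_sum E W {} {}\<bar> \<le> 1"
proof (cases "W = {}")
  case True
  then have "{S. indep_set W E S \<and> {} \<subseteq> S \<and> S \<inter> {} = {}} = {{}}" unfolding indep_set_def by auto
  then show ?thesis unfolding alt_sum_def by simp
next
  case False
  then obtain v where v: "v \<in> W" by blast
  interpret S: sieve E W "alt_sum E W" by (rule sieve_alt_sum) (use W sym irr IH in auto)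
  have toggle: "alt_sum E W {u} {} = - alt_sum E W {} (nbhd E W u \<union> {u})" if "u \<in> W" for u
    using alt_sum_toggle[where E = E and X = "{}" and Y = "{}", OF W _ _ that] sym irr by simp
  have no_critical: False if "sieve E W F" "F {} {} = 2"
    "\<And>u. u \<in> W \<Longrightarrow> F {u} {} = - F {} (nbhd E W u \<union> {u})" for F
  proof -
    have "critical E W F"
      unfolding critical_def critical_axioms_def using that False by blast
    then have "\<exists>cs. induced_cycle W E cs \<and> 3 dvd length cs" by (rule critical.induced_cycle_exists)
    then show False using ter unfolding ternary_def by blast
  qed
  have nt: "({} \<union> {v}) \<inter> W \<noteq> {}" "({v} \<union> {}) \<inter> W \<noteq> {}" using v by auto
  have "\<bar>alt_sum E W {} {}\<bar> \<le> 2"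
    using S.split[of "{}" "{}" v] S.bound[OF nt(1)] S.bound[OF nt(2)] by linarith
  moreover have "alt_sum E W {} {} \<noteq> 2"
    using no_critical[OF S.sieve_axioms] toggle by blast
  moreover have "alt_sum E W {} {} \<noteq> - 2"
    using no_critical[OF sieve_neg[OF S.sieve_axioms]] toggle by auto
  ultimately show ?thesis by linarith
qed

lemma ternary_tame:
  assumes "finite W" and sym: "\<And>a b. E a b \<Longrightarrow> E b a" and irr: "\<And>a. \<not> E a a"
    and "ternary W E"
  shows "tame E W"
  using assms(1,4)
proof (induction W rule: finite_psubset_induct)
  case (psubset W)
  have IH: "tame E W'" if "W' \<subset> W" for W'
    using psubset.IH[OF that] ternary_subset[OF psubset.prems] that by blast
  have b0: "\<bar>alt_sum E W {} {}\<bar> \<le> 1"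
    by (rule ternary_alt_sum_bound) (use psubset sym irr IH in auto)
  interpret S: sieve E W "alt_sum E W"
    by (rule sieve_alt_sum) (use psubset sym irr IH in auto)
  have non: "alt_sum E W {} {} * alt_sum E W {} {a, b} \<le> alt_sum E W {} {a} * alt_sum E W {} {b}"
    if "a \<in> W" "b \<in> W" "a \<noteq> b" "\<not> E a b" for a b
    by (rule turn_nonadjacent) (use psubset sym irr IH b0 that in auto)
  have toggle: "alt_sum E W (insert u X) Y = - alt_sum E W X (Y \<union> nbhd E W u \<union> {u})"
    if "u \<in> W" "u \<notin> X" "u \<notin> Y" for u X Y
    by (rule alt_sum_toggle) (use psubset sym irr that in auto)
  have tri: "\<not> E a c" if "a \<in> W" "b \<in> W" "c \<in> W" "E a b" "E b c" for a b c
    by (rule ternary_no_triangle[of W E a b c]) (use psubset.prems sym irr that in auto)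
  show ?case
    unfolding tame_def
  proof (intro conjI allI impI)
    show "\<bar>alt_sum E W {} {}\<bar> \<le> 1" by (rule b0)
    fix a b :: 'a assume ab: "a \<noteq> b"
    show "alt_sum E W {} {} * alt_sum E W {} {a, b} \<le> alt_sum E W {} {a} * alt_sum E W {} {b}"
    proof (cases "a \<in> W \<and> b \<in> W")
      case True
      then show ?thesis
      proof (cases "E a b")
        case e: True
        show ?thesis
          by (rule S.turn_adjacent[OF toggle non tri]) (use True e in auto)
      qed (use non ab True in blast)
    next
      case False
      then show ?thesis
        using alt_sum_outside[of a W E "{}" "{b}"] alt_sum_outside[of a W E "{}" "{}"]
          alt_sum_outside[of b W E "{}" "{a}"] alt_sum_outside[of b W E "{}" "{}"]
        by (auto simp: insert_commute mult.commute)
    qed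
  qed
qed

section \<open>From the independence polynomial to decycling sets\<close>

lemma indep_poly_alt_sum:
  assumes "finite V"
  shows "indep_poly V E (- 1 :: int) = alt_sum E V {} {}"
proof -
  let ?I = "{S. indep_set V E S}"
  have fin: "finite ?I" using finite_indep[OF assms, of E "\<lambda>_. True"] by simp
  have "card ` ?I \<subseteq> {..card V}" using assms card_mono unfolding indep_set_def by blast
  then have "(\<Sum>k\<le>card V. \<Sum>S | S \<in> ?I \<and> card S = k. (- 1 :: int) ^ card S) = (\<Sum>S\<in>?I. (- 1) ^ card S)"
    by (intro sum.group fin) auto
  moreover have "(\<Sum>S | S \<in> ?I \<and> card S = k. (- 1 :: int) ^ card S) = int (indep_count V E k) * (- 1) ^ k" for k
    unfolding indep_count_def by simp
  ultimately show ?thesis unfolding indep_poly_def alt_sum_def by simp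
qed

lemma alt_sum_by_trace:
  assumes V: "finite V" and D: "D \<subseteq> V"
  shows "alt_sum E V {} {} = (\<Sum>S\<in>Ind D E. alt_sum E V S (D - S))"
proof -
  let ?I = "{S. indep_set V E S}"
  have fin: "finite ?I" using finite_indep[OF V, of E "\<lambda>_. True"] by simp
  have finD: "finite (Ind D E)"
    unfolding Ind_def using finite_indep[OF finite_subset[OF D V], of E "\<lambda>_. True"] by simp
  have "(\<lambda>S. S \<inter> D) ` ?I \<subseteq> Ind D E" unfolding Ind_def indep_set_def by auto
  then have "(\<Sum>S\<in>Ind D E. \<Sum>T | T \<in> ?I \<and> T \<inter> D = S. (- 1 :: int) ^ card T) = (\<Sum>T\<in>?I. (- 1) ^ card T)"
    by (intro sum.group fin finD)
  moreover have "(\<Sum>T | T \<in> ?I \<and> T \<inter> D = S. (- 1 :: int) ^ card T) = alt_sum E V S (D - S)"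
    if "S \<in> Ind D E" for S
  proof -
    have "{T. T \<in> ?I \<and> T \<inter> D = S} = {T. indep_set V E T \<and> S \<subseteq> T \<and> T \<inter> (D - S) = {}}"
      using that unfolding Ind_def indep_set_def by blast
    then show ?thesis unfolding alt_sum_def by simp
  qed
  ultimately show ?thesis unfolding alt_sum_def[of E V "{}" "{}"] by simp
qed

text \<open>Fixing the trace \<open>S\<close> on \<open>D\<close> leaves, up to sign, the count on
  \<open>V - D\<close> without the neighbours of \<open>S\<close>. This is an induced subgraph of a
  ternary graph, so each trace contributes at most 1.\<close>

lemma alt_sum_le_decycling:
  assumes V: "finite V" and sym: "\<And>a b. E a b \<Longrightarrow> E b a" and irr: "\<And>a. \<not> E a a"
    and D: "D \<in> decycling3 V E"
  shows "\<bar>alt_sum E V {} {}\<bar> \<le> int (card (Ind D E))"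
proof -
  have DV: "D \<subseteq> V" and ter: "ternary (V - D) E" using D unfolding decycling3_def by auto
  have "\<bar>alt_sum E V S (D - S)\<bar> \<le> 1" if S: "S \<in> Ind D E" for S
  proof -
    let ?W = "V - (D - S) - S - {b. \<exists>a\<in>S. E a b}"
    have SD: "S \<subseteq> D" and "indep_set V E S" using S DV unfolding Ind_def indep_set_def by auto
    have "alt_sum E V S ((D - S) \<union> {}) = (- 1) ^ card S * alt_sum E ?W {} {}"
      by (rule alt_sum_reduce) (use V sym \<open>indep_set V E S\<close> in auto)
    moreover have "?W \<subseteq> V - D" using SD by blast
    then have "tame E ?W"
      by (intro ternary_tame ternary_subset[OF ter]) (use V sym irr in auto)
    ultimately show ?thesis unfolding tame_def by (simp add: abs_mult power_abs)
  qed
  then have 1: "(\<Sum>S\<in>Ind D E. \<bar>alt_sum E V S (D - S)\<bar>) \<le> (\<Sum>S\<in>Ind D E. 1)"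
    by (rule sum_mono)
  have "\<bar>alt_sum E V {} {}\<bar> \<le> (\<Sum>S\<in>Ind D E. \<bar>alt_sum E V S (D - S)\<bar>)"
    unfolding alt_sum_by_trace[OF V DV, of E] by (rule sum_abs)
  also note 1
  finally show ?thesis by simp
qed

theorem theorem2p1:
  fixes V :: "'a set" and E :: "'a \<Rightarrow> 'a \<Rightarrow> bool"
  assumes "simple_graph V E"
  shows "\<bar>indep_poly V E (-1 :: int)\<bar> \<le> int (Min ((\<lambda>D. card (Ind D E)) ` decycling3 V E))
       \<and> Min ((\<lambda>D. card (Ind D E)) ` decycling3 V E) \<le> 2 ^ phi3 V E"
proof -
  have V: "finite V" and sym: "E a b \<Longrightarrow> E b a" and irr: "\<not> E a a" for a b
    using assms unfolding simple_graph_def by auto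
  have "ternary {} E" unfolding ternary_def induced_cycle_def by auto
  then have ne: "decycling3 V E \<noteq> {}" unfolding decycling3_def by auto
  have fin: "finite (decycling3 V E)"
    by (rule finite_subset[of _ "Pow V"]) (use V in \<open>auto simp: decycling3_def\<close>)
  have "Min ((\<lambda>D. card (Ind D E)) ` decycling3 V E) \<in> (\<lambda>D. card (Ind D E)) ` decycling3 V E"
    using fin ne by (intro Min_in) auto
  then obtain D where D: "D \<in> decycling3 V E"
    and D': "Min ((\<lambda>D. card (Ind D E)) ` decycling3 V E) = card (Ind D E)" by blast
  have "\<bar>alt_sum E V {} {}\<bar> \<le> int (card (Ind D E))"
    by (rule alt_sum_le_decycling) (use V sym irr D in auto)
  then have 1: "\<bar>indep_poly V E (-1 :: int)\<bar> \<le> int (Min ((\<lambda>D. card (Ind D E)) ` decycling3 V E))"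
    unfolding D' indep_poly_alt_sum[OF V] .
  have "phi3 V E \<in> card ` decycling3 V E"
    unfolding phi3_def using fin ne by (intro Min_in) auto
  then obtain C where C: "C \<in> decycling3 V E" "phi3 V E = card C" by blast
  have finC: "finite C" using C(1) V finite_subset unfolding decycling3_def by blast
  have "Min ((\<lambda>D. card (Ind D E)) ` decycling3 V E) \<le> card (Ind C E)"
    using fin C(1) by (intro Min_le) auto
  also have "\<dots> \<le> card (Pow C)"
    using finC by (intro card_mono) (auto simp: Ind_def indep_set_def)
  also have "\<dots> = 2 ^ phi3 V E" using C(2) finC by (simp add: card_Pow)
  finally show ?thesis using 1 by blast
qed

end
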